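(* Let $\rho>0$ and let $(C(t),M(t))$ be the continuous time cat and mouse Markov process on $\mathbb{N}^2$ associated with the $M/M/\infty$ $Q$-matrix $q(x,x+1)=\rho$, $q(x,x-1)=x$, $x\in\mathbb{N}$. If $C(0)=M(0)=n$ and $$T_0=\inf\{s>0: C(s)=0\},$$ then, as $n$ goes to infinity, the random variable $M(T_0)/n$ converges in distribution to a random variable $F$ on $[0,1]$ such that $\mathbb{P}(F\le x)=x^\rho$ for $x\in[0,1]$.
   Context: $\mathbb{N}=\{0,1,2,\dots\}$. For a $Q$-matrix $Q=(q(x,y))$ on a discrete set ${\cal S}$ with $q_x=\sum_{y\ne x}q(x,y)<\infty$, put $p(x,y)=q(x,y)/q_x$ for $x\ne y$ and $p(x,x)=0$. The associated cat and mouse process $(C(t),M(t))$ is the Markov process on ${\cal S}^2$ with infinitesimal generator $$\Omega(f)(x,y)=\sum_{z\in{\cal S}}q(x,z)[f(z,y)-f(x,y)]\mathbf{1}_{\{x\ne y\}}+\sum_{z,z'\in{\cal S}}q_xp(x,z)p(x,z')[f(z,z')-f(x,x)]\mathbf{1}_{\{x=y\}}$$ for functions $f$ on ${\cal S}^2$ vanishing outside a finite set. That is, when cat and mouse are at different sites only the cat moves, according to $Q$; when both are at $x$, after an exponential time with rate $q_x$ they jump simultaneously and independently, each according to $p(x,\cdot)$. For the $M/M/\infty$ $Q$-matrix, all off-diagonal entries other than $q(x,x+1)=\rho$ and $q(x,x-1)=x$ are $0$. *)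

theory Defs
  imports "HOL-Probability.Probability"
begin

definition transition_semigroup :: "(real \<Rightarrow> 's \<Rightarrow> 's pmf) \<Rightarrow> bool" where
  "transition_semigroup P \<longleftrightarrow>
     (\<forall>x. P 0 x = return_pmf x) \<and>
     (\<forall>s\<ge>0. \<forall>t\<ge>0. \<forall>x. P (s + t) x = bind_pmf (P s x) (P t))"

text \<open>
  The operator \<open>L\<close> only matters on functions vanishing outside a finite set. On such functions
  convergence of the difference quotients is required pointwise: for unbounded rates it need
  not be uniform.
\<close>

definition has_generator ::
    "(real \<Rightarrow> 's \<Rightarrow> 's pmf) \<Rightarrow> (('s \<Rightarrow> real) \<Rightarrow> 's \<Rightarrow> real) \<Rightarrow> bool" where
  "has_generator P L \<longleftrightarrow>
     (\<forall>f. finite {x. f x \<noteq> 0} \<longrightarrow>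
        (\<forall>x. ((\<lambda>t. (measure_pmf.expectation (P t x) f - f x) / t) \<longlongrightarrow> L f x) (at_right 0)))"

definition natural_filtration :: "'a measure \<Rightarrow> (real \<Rightarrow> 'a \<Rightarrow> 's) \<Rightarrow> real \<Rightarrow> 'a set set" where
  "natural_filtration M X s =
     sigma_sets (space M) {X u -` B \<inter> space M | u B. 0 \<le> u \<and> u \<le> s}"

definition markov_wrt_semigroup ::
    "'a measure \<Rightarrow> (real \<Rightarrow> 'a \<Rightarrow> 's) \<Rightarrow> (real \<Rightarrow> 's \<Rightarrow> 's pmf) \<Rightarrow> bool" where
  "markov_wrt_semigroup M X P \<longleftrightarrow>
     (\<forall>s\<ge>0. \<forall>t\<ge>0. \<forall>A\<in>natural_filtration M X s. \<forall>y.
        measure M {\<omega>\<in>A. X (s + t) \<omega> = y} =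
        (LINT \<omega>|M. indicator A \<omega> * pmf (P t (X s \<omega>)) y))"

text \<open>
  Right-continuity with left limits for the discrete topology on the state space; left limits
  are states, so a path has only finitely many jumps in a bounded time interval.
\<close>

definition cadlag_path :: "(real \<Rightarrow> 's) \<Rightarrow> bool" where
  "cadlag_path x \<longleftrightarrow>
     (\<forall>t\<ge>0. eventually (\<lambda>s. x s = x t) (at_right t)) \<and>
     (\<forall>t>0. \<exists>z. eventually (\<lambda>s. x s = z) (at_left t))"

definition markov_process_with_generator ::
    "'a measure \<Rightarrow> (real \<Rightarrow> 'a \<Rightarrow> 's :: countable) \<Rightarrow> (('s \<Rightarrow> real) \<Rightarrow> 's \<Rightarrow> real) \<Rightarrow> bool" where
  "markov_process_with_generator M X L \<longleftrightarrow>
     prob_space M \<and>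
     (\<forall>t\<ge>0. X t \<in> measurable M (count_space UNIV)) \<and>
     (\<forall>\<omega>\<in>space M. cadlag_path (\<lambda>t. X t \<omega>)) \<and>
     (\<exists>P. transition_semigroup P \<and> has_generator P L \<and> markov_wrt_semigroup M X P)"

definition total_rate :: "('s \<Rightarrow> 's \<Rightarrow> real) \<Rightarrow> 's \<Rightarrow> real" where
  "total_rate q x = (\<Sum>\<^sub>\<infinity>y\<in>- {x}. q x y)"

definition jump_prob :: "('s \<Rightarrow> 's \<Rightarrow> real) \<Rightarrow> 's \<Rightarrow> 's \<Rightarrow> real" where
  "jump_prob q x y = (if x = y then 0 else q x y / total_rate q x)"

definition cat_mouse_generator ::
    "('s \<Rightarrow> 's \<Rightarrow> real) \<Rightarrow> ('s \<times> 's \<Rightarrow> real) \<Rightarrow> 's \<times> 's \<Rightarrow> real" where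
  "cat_mouse_generator q f = (\<lambda>(x, y).
     (\<Sum>\<^sub>\<infinity>z. q x z * (f (z, y) - f (x, y))) * of_bool (x \<noteq> y) +
     (\<Sum>\<^sub>\<infinity>(z, z').
        total_rate q x * jump_prob q x z * jump_prob q x z' * (f (z, z') - f (x, x))) *
       of_bool (x = y))"

definition mm_inf_rate :: "real \<Rightarrow> nat \<Rightarrow> nat \<Rightarrow> real" where
  "mm_inf_rate \<rho> x y =
     (if y = x + 1 then \<rho> else if x = y + 1 then real x
      else if y = x then - (\<rho> + real x) else 0)"

text \<open>The value is \<open>\<infinity>\<close> if \<open>z\<close> is never visited at a positive time.\<close>

definition hitting_time :: "(real \<Rightarrow> 'a \<Rightarrow> 's) \<Rightarrow> 's \<Rightarrow> 'a \<Rightarrow> ennreal" where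
  "hitting_time X z \<omega> = Inf {ennreal s | s. 0 < s \<and> X s \<omega> = z}"

end

theory Submission
  imports Defs "HOL-Real_Asymp.Real_Asymp"
begin

text \<open>
  While cat and mouse are together at a high site \<open>m\<close>, their next common jump is most likely one
  step down for both. With probability about \<open>\<rho> / m\<close> the mouse alone goes down; then the cat is
  above the mouse and meets it again at \<open>m - 1\<close>. Also with probability about \<open>\<rho> / m\<close> the mouse
  alone goes up; then the cat is below the mouse and almost certainly reaches \<open>0\<close> before climbing
  back, so that the mouse keeps its site. Hence the mouse gets from \<open>n\<close> to \<open>x * n\<close> with
  probability about the product of \<open>1 - \<rho> / m\<close> over \<open>x * n < m \<le> n\<close>, which tends to
  \<open>x powr \<rho>\<close>.

  The proof turns this into estimates by test functions instead of following the jumps. If a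
  function is subharmonic for the generator while the cat is away from \<open>0\<close>, is at most \<open>1\<close>, and is at most
  the indicator of \<open>A\<close> when the cat is at \<open>0\<close>, then its value at the starting point is a lower
  bound for the probability that the cat reaches \<open>0\<close> and the mouse is in \<open>A\<close> at that time
  (\<open>subharmonic_lower_bound\<close>). The function \<open>profile\<close>, built from the scale function of the queue
  and the powers \<open>(k / m) powr \<theta>\<close>, yields with \<open>\<theta> = \<rho>\<close> a lower bound
  (\<open>mouse_site_prob_lower\<close>) and with any \<open>\<theta> < \<rho>\<close> an upper bound
  (\<open>mouse_site_prob_upper\<close>) for the probability that the mouse ends at or below \<open>k\<close>. These
  squeeze the distribution functions (\<open>tendsto_power_law\<close>).

  The comparison principle rests on optional stopping at the exit from a finite set
  (\<open>exit_probability_bound\<close>). Only the Markov property at fixed times and the pointwise generator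
  on functions of finite support are given, so the process is observed on the grid of mesh
  \<open>1 / 2 ^ m\<close>. On a finite set a positive generator makes the mean of the function increase in
  each step of a fine grid (\<open>skeleton_exit_bound\<close>), and for a right-continuous path with discrete
  values the first visit of the grid to a set eventually occurs in the state of the first visit
  of the path (\<open>skeleton_hits_eventually\<close>).
\<close>

section \<open>Optional stopping along a skeleton\<close>

lemma natural_filtration_sets:
  assumes "\<And>t. t \<ge> 0 \<Longrightarrow> X t \<in> measurable M (count_space UNIV)"
    and "A \<in> natural_filtration M X s"
  shows "A \<in> sets M"
proof -
  have "{X u -` B \<inter> space M | u B. 0 \<le> u \<and> u \<le> s} \<subseteq> sets M"
    using assms(1) by (auto intro!: measurable_sets[of _ M "count_space UNIV"])
  from sets.sigma_sets_subset[OF this] assms(2) show ?thesis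
    unfolding natural_filtration_def by blast
qed

text \<open>
  This membership lets the Markov property be applied, for a skeleton with mesh \<open>h\<close>, on the
  event that the skeleton has stayed in \<open>S\<close> so far.
\<close>

lemma skeleton_event_in_natural_filtration:
  fixes h :: real
  assumes "h \<ge> 0"
  shows "{\<omega> \<in> space M. \<forall>j\<le>k. X (real j * h) \<omega> \<in> S} \<in> natural_filtration M X (real k * h)"
proof -
  let ?G = "{X u -` B \<inter> space M | u B. 0 \<le> u \<and> u \<le> real k * h}"
  have eq: "{\<omega> \<in> space M. \<forall>j\<le>k. X (real j * h) \<omega> \<in> S}
      = (\<Inter>j\<in>{..k}. X (real j * h) -` S \<inter> space M)"
    by auto
  interpret sigma_algebra "space M" "sigma_sets (space M) ?G"
    by (rule sigma_algebra_sigma_sets) auto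
  have 1: "X (real j * h) -` S \<inter> space M \<in> sigma_sets (space M) ?G" if "j \<le> k" for j
  proof -
    have "0 \<le> real j * h" "real j * h \<le> real k * h"
      using that assms by (auto intro: mult_right_mono)
    then show ?thesis by (intro sigma_sets.Basic) blast
  qed
  have "(\<Inter>j\<in>{..k}. X (real j * h) -` S \<inter> space M) \<in> sigma_sets (space M) ?G"
  proof (rule finite_INT)
    show "finite {..k}" by (rule finite_atMost)
    show "{..k} \<noteq> {}" by (metis atMost_iff empty_iff order_refl)
    fix j assume "j \<in> {..k}"
    then show "X (real j * h) -` S \<inter> space M \<in> sigma_sets (space M) ?G"
      by (intro 1) simp
  qed
  then show ?thesis unfolding natural_filtration_def eq .
qed

text \<open>
  Point masses span the functions of finite support. The Markov property is given for point
  masses, the generator for functions of finite support; this decomposition connects the two.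
\<close>

lemma finite_support_sum:
  fixes f :: "'s \<Rightarrow> real"
  assumes "finite {x. f x \<noteq> 0}"
  shows "f x = (\<Sum>y\<in>{x. f x \<noteq> 0}. f y * of_bool (x = y))"
proof (cases "f x = 0")
  case True
  have "(\<Sum>y\<in>{x. f x \<noteq> 0}. f y * of_bool (x = y)) = 0"
    using True by (intro sum.neutral) auto
  then show ?thesis using True by simp
next
  case False
  have "(\<Sum>y\<in>{x. f x \<noteq> 0}. f y * of_bool (x = y)) = (\<Sum>y\<in>{x}. f y * of_bool (x = y))"
    using assms False by (intro sum.mono_neutral_right) auto
  then show ?thesis by simp
qed

lemma markov_expectation:
  fixes X :: "real \<Rightarrow> 'a \<Rightarrow> 's :: countable" and f :: "'s \<Rightarrow> real"
  assumes "prob_space M"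
    and X: "\<And>t. t \<ge> 0 \<Longrightarrow> X t \<in> measurable M (count_space UNIV)"
    and markov: "markov_wrt_semigroup M X P"
    and "s \<ge> 0" "t \<ge> 0" and A: "A \<in> natural_filtration M X s"
    and f: "finite {x. f x \<noteq> 0}"
  shows "(LINT \<omega>|M. indicator A \<omega> * f (X (s + t) \<omega>)) =
         (LINT \<omega>|M. indicator A \<omega> * measure_pmf.expectation (P t (X s \<omega>)) f)"
proof -
  interpret prob_space M by fact
  let ?F = "{x. f x \<noteq> 0}"
  have AM[measurable]: "A \<in> sets M" using natural_filtration_sets[OF X A] .
  have Xs[measurable]: "X s \<in> measurable M (count_space UNIV)"
    and Xst[measurable]: "X (s+t) \<in> measurable M (count_space UNIV)"
    using X assms by auto
  have set_y: "{\<omega>\<in>A. X (s + t) \<omega> = y} \<in> sets M" for y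
  proof -
    have "{\<omega>\<in>A. X (s + t) \<omega> = y} = {\<omega>\<in>space M. \<omega> \<in> A \<and> X (s + t) \<omega> = y}"
      using sets.sets_into_space[OF AM] by auto
    then show ?thesis by simp
  qed
  have "(LINT \<omega>|M. indicator A \<omega> * f (X (s + t) \<omega>))
      = (LINT \<omega>|M. (\<Sum>y\<in>?F. f y * indicator {\<omega>\<in>A. X (s + t) \<omega> = y} \<omega>))"
    by (subst finite_support_sum[OF f])
      (auto simp: sum_distrib_left indicator_def intro!: Bochner_Integration.integral_cong sum.cong)
  also have "\<dots> = (\<Sum>y\<in>?F. f y * measure M {\<omega>\<in>A. X (s + t) \<omega> = y})"
    using set_y by (subst Bochner_Integration.integral_sum)
      (auto intro!: sum.cong integrable_mult_right simp: less_top[symmetric] sets.Int_space_eq2)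
  also have "\<dots> = (\<Sum>y\<in>?F. f y * (LINT \<omega>|M. indicator A \<omega> * pmf (P t (X s \<omega>)) y))"
    using markov assms unfolding markov_wrt_semigroup_def by auto
  also have "\<dots> = (LINT \<omega>|M. (\<Sum>y\<in>?F. f y * (indicator A \<omega> * pmf (P t (X s \<omega>)) y)))"
  proof (subst Bochner_Integration.integral_sum)
    fix y
    have [measurable]: "(\<lambda>\<omega>. pmf (P t (X s \<omega>)) y) \<in> borel_measurable M"
      using measurable_compose[OF Xs, of "\<lambda>x. pmf (P t x) y" borel] by simp
    show "integrable M (\<lambda>\<omega>. f y * (indicator A \<omega> * pmf (P t (X s \<omega>)) y))"
      by (intro integrable_mult_right integrable_const_bound[where B=1] AE_I2)
        (auto simp: indicator_def pmf_le_1)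
  qed simp
  also have "\<dots> = (LINT \<omega>|M. indicator A \<omega> * measure_pmf.expectation (P t (X s \<omega>)) f)"
  proof (intro Bochner_Integration.integral_cong refl)
    fix \<omega>
    have "measure_pmf.expectation (P t (X s \<omega>)) f = (\<Sum>y\<in>?F. f y * pmf (P t (X s \<omega>)) y)"
      using f by (intro integral_measure_pmf_real) auto
    then show "(\<Sum>y\<in>?F. f y * (indicator A \<omega> * pmf (P t (X s \<omega>)) y)) =
       indicator A \<omega> * measure_pmf.expectation (P t (X s \<omega>)) f"
      by (simp add: sum_distrib_left mult_ac)
  qed
  finally show ?thesis .
qed

text \<open>
  Discrete optional stopping. On \<open>S\<close> one step raises the mean of \<open>f\<close>, by at least some
  \<open>\<epsilon> > 0\<close> since \<open>S\<close> is finite. So each unit of time spent in \<open>S\<close> adds \<open>\<epsilon>\<close> to the mean of the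
  bounded function \<open>f\<close>; this forces the chain out of \<open>S\<close> almost surely, and at the exit \<open>f\<close> has
  mean at least \<open>f x\<^sub>0\<close>. There \<open>f\<close> is dominated by the indicator of \<open>D\<close>.
  The step condition is the Markov property restricted to the survival events, with \<open>g\<close> the
  image of \<open>f\<close> under one transition.
\<close>

lemma skeleton_exit_bound:
  fixes Z :: "nat \<Rightarrow> 'a \<Rightarrow> 's :: countable" and f g :: "'s \<Rightarrow> real"
  assumes "prob_space M"
    and Z: "\<And>k. Z k \<in> measurable M (count_space UNIV)"
    and disj: "D \<inter> S = {}"
    and init: "AE \<omega> in M. Z 0 \<omega> = x\<^sub>0" and "x\<^sub>0 \<in> S" and "finite S"
    and step: "\<And>k. (LINT \<omega>|M. indicator {\<omega>\<in>space M. \<forall>j\<le>k. Z j \<omega> \<in> S} \<omega> * f (Z (Suc k) \<omega>))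
        = (LINT \<omega>|M. indicator {\<omega>\<in>space M. \<forall>j\<le>k. Z j \<omega> \<in> S} \<omega> * g (Z k \<omega>))"
    and increase: "\<And>x. x \<in> S \<Longrightarrow> f x < g x"
    and outside: "\<And>x. x \<notin> S \<Longrightarrow> f x \<le> indicator D x"
    and bound: "\<And>x. \<bar>f x\<bar> \<le> B"
  shows "f x\<^sub>0 \<le> measure M {\<omega>\<in>space M. \<exists>k. Z k \<omega> \<in> D \<and> (\<forall>j<k. Z j \<omega> \<in> S)}"
proof -
  interpret prob_space M by fact
  note [measurable] = Z
  define A where "A k = {\<omega>\<in>space M. \<forall>j\<le>k. Z j \<omega> \<in> S}" for k
  define H where "H k = {\<omega>\<in>space M. \<exists>i\<le>k. Z i \<omega> \<in> D \<and> (\<forall>j<i. Z j \<omega> \<in> S)}" for k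
  have [measurable]: "A k \<in> sets M" "H k \<in> sets M" for k
    unfolding A_def H_def by measurable
  define \<epsilon> where "\<epsilon> = Min ((\<lambda>x. g x - f x) ` S)"
  have eps: "\<epsilon> > 0" "\<And>x. x \<in> S \<Longrightarrow> f x + \<epsilon> \<le> g x"
  proof -
    show "\<epsilon> > 0" unfolding \<epsilon>_def using \<open>x\<^sub>0 \<in> S\<close> \<open>finite S\<close> increase by (subst Min_gr_iff) auto
    fix x assume "x \<in> S"
    then have "\<epsilon> \<le> g x - f x" unfolding \<epsilon>_def using \<open>finite S\<close> by (intro Min_le) auto
    then show "f x + \<epsilon> \<le> g x" by simp
  qed
  define G where "G = Max ((\<lambda>x. \<bar>g x\<bar>) ` S)"
  have G: "\<bar>g x\<bar> \<le> G" if "x \<in> S" for x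
    unfolding G_def using that \<open>finite S\<close> by (intro Max_ge) auto
  have G0: "G \<ge> 0" using G[OF \<open>x\<^sub>0 \<in> S\<close>] by linarith
  have B0: "B \<ge> 0" using bound[of x\<^sub>0] by linarith
  have fZ[measurable]: "(\<lambda>\<omega>. f (Z k \<omega>)) \<in> borel_measurable M"
    and gZ[measurable]: "(\<lambda>\<omega>. g (Z k \<omega>)) \<in> borel_measurable M" for k
    using measurable_compose[OF Z, of f borel] measurable_compose[OF Z, of g borel] by auto
  have intf: "integrable M (\<lambda>\<omega>. indicator (A k) \<omega> * f (Z l \<omega>))" for k l
    using bound B0 by (intro integrable_const_bound[where B=B] AE_I2) (auto simp: indicator_def)
  have intg: "integrable M (\<lambda>\<omega>. indicator (A k) \<omega> * g (Z k \<omega>))" for k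
    using G G0 by (intro integrable_const_bound[where B=G] AE_I2) (auto simp: indicator_def A_def)
  have intA: "integrable M (\<lambda>\<omega>. c * indicator (A k) \<omega> :: real)" for c k
    by (intro integrable_mult_right) (auto simp: less_top[symmetric])
  \<comment> \<open>The right-hand side dominates the mean of \<open>f\<close> at the chain stopped on leaving \<open>S\<close>;
    the sum on the left is the gain accumulated until then.\<close>
  have main: "f x\<^sub>0 + \<epsilon> * (\<Sum>j<k. measure M (A j)) \<le>
      (LINT \<omega>|M. indicator (A k) \<omega> * f (Z k \<omega>)) + measure M (H k)" for k
  proof (induction k)
    case 0
    have "(LINT \<omega>|M. indicator (A 0) \<omega> * f (Z 0 \<omega>)) = (LINT \<omega>|M. f x\<^sub>0)"
    proof (intro integral_cong_AE)
      show "AE \<omega> in M. indicator (A 0) \<omega> * f (Z 0 \<omega>) = f x\<^sub>0"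
        using init AE_space by eventually_elim (use \<open>x\<^sub>0 \<in> S\<close> in \<open>auto simp: A_def\<close>)
    qed auto
    then show ?case by (simp add: prob_space)
  next
    case (Suc k)
    have "(LINT \<omega>|M. indicator (A k) \<omega> * f (Z k \<omega>)) + \<epsilon> * measure M (A k)
        = (LINT \<omega>|M. indicator (A k) \<omega> * f (Z k \<omega>) + \<epsilon> * indicator (A k) \<omega>)"
      using intf intA by (subst Bochner_Integration.integral_add) (auto simp: A_def)
    also have "\<dots> \<le> (LINT \<omega>|M. indicator (A k) \<omega> * g (Z k \<omega>))"
      using intf intA intg eps(2)
      by (intro integral_mono Bochner_Integration.integrable_add) (auto simp: indicator_def A_def)
    also have "\<dots> = (LINT \<omega>|M. indicator (A k) \<omega> * f (Z (Suc k) \<omega>))"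
      using step[of k] by (simp add: A_def)
    also have "\<dots> \<le> (LINT \<omega>|M. indicator (A (Suc k)) \<omega> * f (Z (Suc k) \<omega>)
        + (indicator (H (Suc k)) \<omega> - indicator (H k) \<omega>))"
    proof (intro integral_mono intf Bochner_Integration.integrable_add Bochner_Integration.integrable_diff)
      fix \<omega> assume w: "\<omega> \<in> space M"
      have mono: "indicator (H k) \<omega> \<le> (indicator (H (Suc k)) \<omega> :: real)"
        by (auto simp: indicator_def H_def) (metis le_SucI)
      show "indicator (A k) \<omega> * f (Z (Suc k) \<omega>) \<le>
          indicator (A (Suc k)) \<omega> * f (Z (Suc k) \<omega>) + (indicator (H (Suc k)) \<omega> - indicator (H k) \<omega>)"
      proof (cases "\<omega> \<in> A k \<and> Z (Suc k) \<omega> \<notin> S")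
        case False
        then have "\<omega> \<in> A k \<longleftrightarrow> \<omega> \<in> A (Suc k)" using w by (auto simp: A_def le_Suc_eq)
        then show ?thesis using mono by (auto simp: indicator_def)
      next
        case True
        then have 1: "\<omega> \<notin> A (Suc k)" by (auto simp: A_def)
        have 2: "\<omega> \<notin> H k" using True disj w by (fastforce simp: A_def H_def)
        have "\<omega> \<in> H (Suc k)" if "Z (Suc k) \<omega> \<in> D"
          using True that w by (auto simp: A_def H_def intro!: exI[of _ "Suc k"])
        then show ?thesis using True 1 2 outside[of "Z (Suc k) \<omega>"]
          by (cases "Z (Suc k) \<omega> \<in> D") (auto simp: indicator_def)
      qed
    qed (auto simp: less_top[symmetric])
    also have "\<dots> = (LINT \<omega>|M. indicator (A (Suc k)) \<omega> * f (Z (Suc k) \<omega>))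
        + (measure M (H (Suc k)) - measure M (H k))"
      using intf by (subst Bochner_Integration.integral_add) (auto simp: less_top[symmetric] H_def)
    finally show ?case using Suc by (simp add: algebra_simps)
  qed
  define H' where "H' = {\<omega>\<in>space M. \<exists>k. Z k \<omega> \<in> D \<and> (\<forall>j<k. Z j \<omega> \<in> S)}"
  have [measurable]: "H' \<in> sets M" unfolding H'_def by measurable
  \<comment> \<open>The inequality above bounds \<open>\<epsilon>\<close> times the mean exit time by \<open>2 * B + 1\<close>, and survival
    probabilities decrease.\<close>
  have A_small: "(\<lambda>k. measure M (A k)) \<longlonglongrightarrow> 0"
  proof (rule tendsto_sandwich[of "\<lambda>_. 0" _ _ "\<lambda>k. (2 * B + 1) / \<epsilon> / real k"])
    show "\<forall>\<^sub>F k in sequentially. measure M (A k) \<le> (2 * B + 1) / \<epsilon> / real k"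
      using eventually_gt_at_top[of 0]
    proof eventually_elim
      case (elim k)
      have "real k * measure M (A k) = (\<Sum>j<k. measure M (A k))" by simp
      also have "\<dots> \<le> (\<Sum>j<k. measure M (A j))"
        by (intro sum_mono finite_measure_mono) (auto simp: A_def)
      finally have "\<epsilon> * (real k * measure M (A k)) \<le> \<epsilon> * (\<Sum>j<k. measure M (A j))"
        using eps(1) by simp
      also have "\<dots> \<le> (LINT \<omega>|M. indicator (A k) \<omega> * f (Z k \<omega>)) + measure M (H k) - f x\<^sub>0"
        using main[of k] by simp
      also have "\<dots> \<le> B + 1 + B"
      proof -
        have "(LINT \<omega>|M. indicator (A k) \<omega> * f (Z k \<omega>)) \<le> B"
          using bound B0 by (intro integral_le_const intf AE_I2) (auto simp: indicator_def abs_le_iff)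
        moreover have "- f x\<^sub>0 \<le> B" using bound[of x\<^sub>0] by linarith
        ultimately show ?thesis using prob_le_1[of "H k"] by linarith
      qed
      finally show ?case using eps(1) elim by (simp add: field_simps)
    qed
    show "(\<lambda>k. (2 * B + 1) / \<epsilon> / real k) \<longlonglongrightarrow> 0" by real_asymp
  qed auto
  have "f x\<^sub>0 \<le> B * measure M (A k) + measure M H'" for k
  proof -
    have "f x\<^sub>0 \<le> f x\<^sub>0 + \<epsilon> * (\<Sum>j<k. measure M (A j))"
      using eps(1) by (simp add: sum_nonneg)
    also have "\<dots> \<le> (LINT \<omega>|M. indicator (A k) \<omega> * f (Z k \<omega>)) + measure M (H k)" by (rule main)
    also have "measure M (H k) \<le> measure M H'"
      by (intro finite_measure_mono) (auto simp: H_def H'_def)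
    also have "(LINT \<omega>|M. indicator (A k) \<omega> * f (Z k \<omega>)) \<le> (LINT \<omega>|M. B * indicator (A k) \<omega>)"
      using bound by (intro integral_mono intf intA) (auto simp: indicator_def abs_le_iff)
    also have "\<dots> = B * measure M (A k)" by (simp add: A_def)
    finally show ?thesis by simp
  qed
  then have "f x\<^sub>0 \<le> B * 0 + measure M H'"
    by (intro LIMSEQ_le_const[OF tendsto_add[OF tendsto_mult_left[OF A_small] tendsto_const]]) auto
  then show ?thesis by (simp add: H'_def)
qed

section \<open>Entrance times of right-continuous paths\<close>

definition first_time :: "(real \<Rightarrow> 's) \<Rightarrow> 's set \<Rightarrow> real" where
  "first_time x K = Inf {t. 0 \<le> t \<and> x t \<in> K}"

lemma cadlag_path_constant_right:
  assumes "cadlag_path x" "0 \<le> t"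
  obtains \<delta> where "\<delta> > 0" "\<And>s. t \<le> s \<Longrightarrow> s < t + \<delta> \<Longrightarrow> x s = x t"
proof -
  from assms have "eventually (\<lambda>s. x s = x t) (at_right t)"
    unfolding cadlag_path_def by auto
  then obtain b where b: "b > t" "\<And>y. y > t \<Longrightarrow> y < b \<Longrightarrow> x y = x t"
    unfolding eventually_at_right_field by auto
  show ?thesis
    using b by (intro that[of "b - t"]) (auto simp: le_less)
qed

lemma first_time_le: "0 \<le> t \<Longrightarrow> x t \<in> K \<Longrightarrow> first_time x K \<le> t"
  unfolding first_time_def by (intro cInf_lower) (auto intro: bdd_belowI[of _ 0])

lemma first_time_nonneg: "0 \<le> t \<Longrightarrow> x t \<in> K \<Longrightarrow> 0 \<le> first_time x K"
  unfolding first_time_def by (intro cInf_greatest) auto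

text \<open>
  Right-continuity in the discrete topology makes a path constant for a while after each time,
  so the infimum of the visits to an arbitrary set \<open>K\<close> is itself a visit.
\<close>

lemma first_time_attained:
  assumes x: "cadlag_path x" and t: "0 \<le> t" "x t \<in> K"
  shows "x (first_time x K) \<in> K"
proof -
  obtain \<delta> where \<delta>: "\<delta> > 0"
    "\<And>s. first_time x K \<le> s \<Longrightarrow> s < first_time x K + \<delta> \<Longrightarrow> x s = x (first_time x K)"
    using cadlag_path_constant_right[OF x first_time_nonneg[of t x K, OF t]] by blast
  have "\<exists>s\<in>{t. 0 \<le> t \<and> x t \<in> K}. s < first_time x K + \<delta>"
    using \<delta>(1) t unfolding first_time_def by (intro cInf_lessD) auto
  then obtain s where "0 \<le> s" "x s \<in> K" "s < first_time x K + \<delta>" by auto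
  with \<delta>(2)[of s] first_time_le[of s x K] show ?thesis by auto
qed

text \<open>
  The path keeps its value at the entrance time \<open>\<tau>\<close> for some \<open>\<delta> > 0\<close>. Once the mesh is below
  \<open>\<delta>\<close>, a grid point falls into that interval, and no earlier grid point can be a visit. Hence
  the entrance state of the skeleton is eventually the entrance state of the path, and
  statements about skeletons, where only the Markov property at fixed times is used, pass to
  the path without a strong Markov property.
\<close>

lemma skeleton_hits_eventually:
  assumes x: "cadlag_path x" and t: "0 \<le> t" "x t \<in> K"
  shows "eventually (\<lambda>m. (\<exists>k. x (real k * (1 / 2 ^ m)) \<in> K) \<and>
      (\<forall>k. x (real k * (1 / 2 ^ m)) \<in> K \<longrightarrow> (\<forall>j<k. x (real j * (1 / 2 ^ m)) \<notin> K) \<longrightarrow>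
        x (real k * (1 / 2 ^ m)) = x (first_time x K))) sequentially"
proof -
  define \<tau> where "\<tau> = first_time x K"
  have \<tau>: "\<tau> \<ge> 0" "x \<tau> \<in> K"
    using first_time_nonneg[of t x K, OF t] first_time_attained[OF x t] by (auto simp: \<tau>_def)
  obtain \<delta> where \<delta>: "\<delta> > 0" "\<And>s. \<tau> \<le> s \<Longrightarrow> s < \<tau> + \<delta> \<Longrightarrow> x s = x \<tau>"
    using cadlag_path_constant_right[OF x \<tau>(1)] by blast
  have "((\<lambda>m. 1 / 2 ^ m :: real) \<longlongrightarrow> 0) sequentially" by real_asymp
  then have "\<forall>\<^sub>F m in sequentially. 1 / 2 ^ m < \<delta>" using \<delta>(1) by (rule order_tendstoD)
  then show ?thesis
  proof eventually_elim
    case (elim m)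
    define h :: real where "h = 1 / 2 ^ m"
    have h: "h > 0" "h < \<delta>" using elim by (auto simp: h_def)
    define k\<^sub>0 where "k\<^sub>0 = nat \<lceil>\<tau> / h\<rceil>"
    have k\<^sub>0: "real k\<^sub>0 = of_int \<lceil>\<tau> / h\<rceil>" using \<tau> h by (simp add: k\<^sub>0_def)
    have ge: "\<tau> \<le> real k\<^sub>0 * h"
      by (simp only: pos_divide_le_eq[OF h(1), symmetric] k\<^sub>0 le_of_int_ceiling)
    have "of_int \<lceil>\<tau> / h\<rceil> < \<tau> / h + 1" by linarith
    then have "real k\<^sub>0 * h < (\<tau> / h + 1) * h"
      using h unfolding k\<^sub>0 by (intro mult_strict_right_mono) auto
    then have lt: "real k\<^sub>0 * h < \<tau> + h" using h by (simp add: distrib_right)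
    have hit: "x (real k\<^sub>0 * h) \<in> K" using \<delta>(2)[of "real k\<^sub>0 * h"] ge lt h \<tau> by auto
    moreover have "x (real k * h) = x \<tau>" if "x (real k * h) \<in> K" "\<forall>j<k. x (real j * h) \<notin> K" for k
    proof -
      have "k \<le> k\<^sub>0" using that(2) hit by (meson not_le)
      then have "real k * h \<le> real k\<^sub>0 * h" using h by (intro mult_right_mono) auto
      then have "real k * h < \<tau> + \<delta>" using lt h by linarith
      moreover have "\<tau> \<le> real k * h"
        unfolding \<tau>_def using that(1) h by (intro first_time_le) auto
      ultimately show ?thesis by (intro \<delta>(2))
    qed
    ultimately show ?case unfolding h_def \<tau>_def by blast
  qed
qed

text \<open>
  The hitting time runs over positive times, the entrance time over nonnegative ones. A path
  that starts in \<open>z\<close> stays there for a positive time, so both infima are \<open>0\<close> in that case.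
\<close>

lemma hitting_time_eq_first_time:
  assumes x: "cadlag_path (\<lambda>t. X t \<omega>)"
  shows "hitting_time X z \<omega> =
    (if \<exists>t\<ge>0. X t \<omega> = z then ennreal (first_time (\<lambda>t. X t \<omega>) {z}) else \<top>)"
proof (cases "\<exists>t\<ge>0. X t \<omega> = z")
  case False
  then have "{ennreal s | s. 0 < s \<and> X s \<omega> = z} = {}" by (auto simp: less_imp_le)
  then have "hitting_time X z \<omega> = \<top>" unfolding hitting_time_def by (simp only: Inf_empty)
  with False show ?thesis by simp
next
  case True
  then obtain t where t: "0 \<le> t" "X t \<omega> \<in> {z}" by auto
  define \<tau> where "\<tau> = first_time (\<lambda>t. X t \<omega>) {z}"
  have \<tau>: "\<tau> \<ge> 0" "X \<tau> \<omega> = z"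
    using first_time_nonneg[OF t(1), of "\<lambda>t. X t \<omega>" "{z}"]
      first_time_attained[OF x t] t by (auto simp: \<tau>_def)
  obtain \<delta> where \<delta>: "\<delta> > 0" "\<And>s. \<tau> \<le> s \<Longrightarrow> s < \<tau> + \<delta> \<Longrightarrow> X s \<omega> = X \<tau> \<omega>"
    using cadlag_path_constant_right[OF x \<tau>(1)] by blast
  have "Inf {ennreal s | s. 0 < s \<and> X s \<omega> = z} = ennreal \<tau>"
  proof (rule antisym)
    show "ennreal \<tau> \<le> Inf {ennreal s | s. 0 < s \<and> X s \<omega> = z}"
      using first_time_le[of _ "\<lambda>t. X t \<omega>" "{z}"]
      by (intro Inf_greatest) (auto simp: \<tau>_def intro!: ennreal_leI)
    show "Inf {ennreal s | s. 0 < s \<and> X s \<omega> = z} \<le> ennreal \<tau>"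
    proof (rule ennreal_le_epsilon)
      fix e :: real assume "0 < e"
      define s where "s = \<tau> + min e (\<delta> / 2)"
      have "\<tau> < s" "s < \<tau> + \<delta>" "s \<le> \<tau> + e" using \<open>0 < e\<close> \<delta>(1) by (auto simp: s_def)
      then have "X s \<omega> = z" "0 < s" using \<delta>(2)[of s] \<tau> by auto
      then have "Inf {ennreal s | s. 0 < s \<and> X s \<omega> = z} \<le> ennreal s" by (intro Inf_lower) auto
      also have "\<dots> \<le> ennreal (\<tau> + e)" using \<open>s \<le> \<tau> + e\<close> by (rule ennreal_leI)
      finally show "Inf {ennreal s | s. 0 < s \<and> X s \<omega> = z} \<le> ennreal \<tau> + ennreal e"
        using \<tau> \<open>0 < e\<close> by simp
    qed
  qed
  with True show ?thesis unfolding hitting_time_def \<tau>_def by simp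
qed

text \<open>
  Skeleton entrance states are measurable and eventually equal to the entrance state of the
  path. On paths that avoid \<open>K\<close> the value at time \<open>0\<close> serves as a default.
\<close>

lemma measurable_at_first_time:
  fixes X :: "real \<Rightarrow> 'a \<Rightarrow> 's :: countable" and v :: "'s \<Rightarrow> real"
  assumes X: "\<And>t. t \<ge> 0 \<Longrightarrow> X t \<in> measurable M (count_space UNIV)"
    and path: "\<And>\<omega>. \<omega> \<in> space M \<Longrightarrow> cadlag_path (\<lambda>t. X t \<omega>)"
  shows "(\<lambda>\<omega>. v (X (if \<exists>t\<ge>0. X t \<omega> \<in> K then first_time (\<lambda>t. X t \<omega>) K else 0) \<omega>))
    \<in> borel_measurable M"
proof -
  define Z where "Z m k = X (real k * (1 / 2 ^ m))" for m k :: nat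
  have [measurable]: "Z m k \<in> measurable M (count_space UNIV)" for m k
    unfolding Z_def by (intro X) auto
  have vZ[measurable]: "(\<lambda>\<omega>. v (Z m k \<omega>)) \<in> borel_measurable M" for m k
    by (rule measurable_compose[of "Z m k" M "count_space UNIV" v]) auto
  define L where "L m \<omega> = (LEAST k. Z m k \<omega> \<in> K)" for m \<omega>
  have [measurable]: "L m \<in> measurable M (count_space UNIV)" for m
    unfolding L_def by measurable
  have [measurable]: "(\<lambda>\<omega>. v (Z m (L m \<omega>) \<omega>)) \<in> borel_measurable M" for m
    by (rule measurable_compose_countable[where f="\<lambda>i \<omega>. v (Z m i \<omega>)"]) measurable
  define Y where "Y m \<omega> = (if \<exists>k. Z m k \<omega> \<in> K then v (Z m (L m \<omega>) \<omega>) else v (Z m 0 \<omega>))" for m \<omega>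
  have Y: "Y m \<in> borel_measurable M" for m unfolding Y_def by measurable
  show ?thesis
  proof (rule borel_measurable_LIMSEQ_real[OF _ Y])
    fix \<omega> assume w: "\<omega> \<in> space M"
    let ?R = "v (X (if \<exists>t\<ge>0. X t \<omega> \<in> K then first_time (\<lambda>t. X t \<omega>) K else 0) \<omega>)"
    have "\<forall>\<^sub>F m in sequentially. Y m \<omega> = ?R"
    proof (cases "\<exists>t\<ge>0. X t \<omega> \<in> K")
      case True
      then obtain t where "0 \<le> t" "X t \<omega> \<in> K" by auto
      from skeleton_hits_eventually[OF path[OF w] this] show ?thesis
      proof eventually_elim
        case (elim m)
        then have ex: "\<exists>k. Z m k \<omega> \<in> K" by (simp add: Z_def)
        have "Z m (L m \<omega>) \<omega> \<in> K" "\<forall>j<L m \<omega>. Z m j \<omega> \<notin> K"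
          using LeastI_ex[OF ex] not_less_Least unfolding L_def by auto
        then have "Z m (L m \<omega>) \<omega> = X (first_time (\<lambda>t. X t \<omega>) K) \<omega>"
          using elim unfolding Z_def by blast
        then show ?case using ex True by (simp add: Y_def)
      qed
    next
      case False
      then show ?thesis by (auto simp: Y_def Z_def)
    qed
    then show "(\<lambda>m. Y m \<omega>) \<longlonglongrightarrow> ?R" by (rule tendsto_eventually)
  qed
qed

section \<open>Leaving a finite set\<close>

text \<open>
  The continuous-time form of optional stopping, for a finite set \<open>S\<close> on which \<open>L f\<close> is strictly
  positive. Pointwise convergence of the difference quotients is uniform on finite sets, so for
  a small mesh the skeleton satisfies the assumptions of the discrete bound. The paths whose
  skeletons leave through \<open>D\<close> for infinitely many meshes leave through \<open>D\<close> themselves.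
  The bound is stated for any event \<open>E\<close> containing these paths, so that their measurability
  need not be settled separately.
\<close>

lemma exit_probability_bound:
  fixes X :: "real \<Rightarrow> 'a \<Rightarrow> 's :: countable" and f :: "'s \<Rightarrow> real"
  assumes process: "markov_process_with_generator M X L"
    and init: "AE \<omega> in M. X 0 \<omega> = x\<^sub>0" and "x\<^sub>0 \<in> S" and "finite S"
    and f: "finite {x. f x \<noteq> 0}"
    and positive: "\<And>x. x \<in> S \<Longrightarrow> L f x > 0"
    and outside: "\<And>x. x \<notin> S \<Longrightarrow> f x \<le> indicator D x"
    and disj: "D \<inter> S = {}"
    and E: "E \<in> sets M"
      "{\<omega>\<in>space M. \<exists>t\<ge>0. X t \<omega> \<in> D \<and> (\<forall>u. 0 \<le> u \<longrightarrow> u < t \<longrightarrow> X u \<omega> \<in> S)} \<subseteq> E"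
  shows "f x\<^sub>0 \<le> measure M E"
proof -
  from process obtain P where "prob_space M"
    and X: "\<And>t. t \<ge> 0 \<Longrightarrow> X t \<in> measurable M (count_space UNIV)"
    and path: "\<And>\<omega>. \<omega> \<in> space M \<Longrightarrow> cadlag_path (\<lambda>t. X t \<omega>)"
    and gen: "has_generator P L"
    and markov: "markov_wrt_semigroup M X P"
    unfolding markov_process_with_generator_def by blast
  interpret prob_space M by fact
  define H where "H m = {\<omega>\<in>space M. \<exists>k. X (real k * (1 / 2 ^ m)) \<omega> \<in> D \<and>
      (\<forall>j<k. X (real j * (1 / 2 ^ m)) \<omega> \<in> S)}" for m :: nat
  have X': "X (real k * (1 / 2 ^ m)) \<in> measurable M (count_space UNIV)" for k m :: nat
    by (intro X) auto
  note [measurable] = X'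
  have [measurable]: "H m \<in> sets M" for m unfolding H_def by measurable
  define B where "B = (\<Sum>x\<in>{x. f x \<noteq> 0}. \<bar>f x\<bar>)"
  have B: "\<bar>f x\<bar> \<le> B" for x
  proof (cases "f x = 0")
    case False
    then show ?thesis unfolding B_def
      using f by (intro member_le_sum) auto
  qed (simp add: B_def sum_nonneg)
  have "eventually (\<lambda>m. f x\<^sub>0 \<le> measure M (H m)) sequentially"
  proof -
    have lim0: "filterlim (\<lambda>m. 1 / 2 ^ m :: real) (at_right 0) sequentially" by real_asymp
    have "\<forall>x\<in>S. \<forall>\<^sub>F t in at_right 0. f x < measure_pmf.expectation (P t x) f"
    proof
      fix x assume "x \<in> S"
      have "((\<lambda>t. (measure_pmf.expectation (P t x) f - f x) / t) \<longlongrightarrow> L f x) (at_right 0)"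
        using gen f unfolding has_generator_def by blast
      then have "\<forall>\<^sub>F t in at_right 0. 0 < (measure_pmf.expectation (P t x) f - f x) / t"
        using positive[OF \<open>x \<in> S\<close>] by (rule order_tendstoD)
      then show "\<forall>\<^sub>F t in at_right 0. f x < measure_pmf.expectation (P t x) f"
        using eventually_at_right_less[of "0::real"]
        by eventually_elim (simp add: zero_less_divide_iff)
    qed
    then have "\<forall>\<^sub>F t in at_right 0. \<forall>x\<in>S. f x < measure_pmf.expectation (P t x) f"
      using \<open>finite S\<close> by (intro eventually_ball_finite)
    from eventually_compose_filterlim[OF this lim0] show ?thesis
    proof eventually_elim
      case (elim m)
      let ?h = "1 / 2 ^ m :: real"
      show ?case unfolding H_def
      proof (rule skeleton_exit_bound[where Z="\<lambda>k. X (real k * ?h)" and B=B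
            and g="\<lambda>x. measure_pmf.expectation (P ?h x) f"])
        fix k
        show "(LINT \<omega>|M. indicator {\<omega> \<in> space M. \<forall>j\<le>k. X (real j * ?h) \<omega> \<in> S} \<omega> *
              f (X (real (Suc k) * ?h) \<omega>)) =
          (LINT \<omega>|M. indicator {\<omega> \<in> space M. \<forall>j\<le>k. X (real j * ?h) \<omega> \<in> S} \<omega> *
              measure_pmf.expectation (P ?h (X (real k * ?h) \<omega>)) f)"
        proof -
          have "real (Suc k) * ?h = real k * ?h + ?h" by (simp only: of_nat_Suc distrib_right mult_1_left add.commute)
          then show ?thesis
            using markov_expectation[OF \<open>prob_space M\<close> X markov, of "real k * ?h" ?h _ f,
                OF _ _ _ skeleton_event_in_natural_filtration f] by simp
        qed
      qed (use elim assms B X' \<open>prob_space M\<close> in auto)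
    qed
  qed
  then obtain m\<^sub>0 where m\<^sub>0: "\<And>m. m \<ge> m\<^sub>0 \<Longrightarrow> f x\<^sub>0 \<le> measure M (H m)"
    unfolding eventually_sequentially by blast
  define U where "U N = (\<Union>m\<in>{N..}. H m)" for N
  have U[measurable]: "U N \<in> sets M" for N unfolding U_def by measurable
  have "(\<lambda>N. measure M (U N)) \<longlonglongrightarrow> measure M (\<Inter>N. U N)"
  proof (intro finite_Lim_measure_decseq)
    show "decseq U" unfolding decseq_def U_def by (intro allI impI UN_mono) auto
  qed (use U in auto)
  moreover have "\<exists>N. \<forall>n\<ge>N. f x\<^sub>0 \<le> measure M (U n)"
  proof (intro exI allI impI)
    fix n assume "m\<^sub>0 \<le> n"
    then have "f x\<^sub>0 \<le> measure M (H n)" by (rule m\<^sub>0)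
    also have "\<dots> \<le> measure M (U n)" by (intro finite_measure_mono) (auto simp: U_def)
    finally show "f x\<^sub>0 \<le> measure M (U n)" .
  qed
  ultimately have "f x\<^sub>0 \<le> measure M (\<Inter>N. U N)" by (rule LIMSEQ_le_const)
  also have "\<dots> \<le> measure M E"
  proof (intro finite_measure_mono E(1) subsetI)
    fix \<omega> assume w: "\<omega> \<in> (\<Inter>N. U N)"
    then have ws: "\<omega> \<in> space M" by (auto simp: U_def H_def)
    have freq: "\<exists>m\<ge>N. \<omega> \<in> H m" for N using w by (auto simp: U_def)
    obtain m k where "X (real k * (1 / 2 ^ m)) \<omega> \<in> D" using freq[of 0] by (auto simp: H_def)
    then have t: "0 \<le> real k * (1 / 2 ^ m :: real)" "X (real k * (1 / 2 ^ m)) \<omega> \<in> - S"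
      using disj by auto
    define \<tau> where "\<tau> = first_time (\<lambda>t. X t \<omega>) (- S)"
    from skeleton_hits_eventually[OF path[OF ws] t] obtain N where N:
      "\<And>m k. m \<ge> N \<Longrightarrow> X (real k * (1 / 2 ^ m)) \<omega> \<in> - S \<Longrightarrow>
          \<forall>j<k. X (real j * (1 / 2 ^ m)) \<omega> \<notin> - S \<Longrightarrow> X (real k * (1 / 2 ^ m)) \<omega> = X \<tau> \<omega>"
      unfolding eventually_sequentially \<tau>_def by blast
    obtain m k where "m \<ge> N" "X (real k * (1 / 2 ^ m)) \<omega> \<in> D"
      "\<forall>j<k. X (real j * (1 / 2 ^ m)) \<omega> \<in> S"
      using freq[of N] by (auto simp: H_def)
    moreover from this disj have "X (real k * (1 / 2 ^ m)) \<omega> = X \<tau> \<omega>" by (intro N) auto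
    ultimately have "X \<tau> \<omega> \<in> D" by (simp only:)
    moreover have "0 \<le> \<tau>" unfolding \<tau>_def using first_time_nonneg[OF t(1), of "\<lambda>t. X t \<omega>" "- S"] t(2) by simp
    moreover have "X u \<omega> \<in> S" if "0 \<le> u" "u < \<tau>" for u
      using first_time_le[of u "\<lambda>t. X t \<omega>" "- S"] that unfolding \<tau>_def by fastforce
    ultimately show "\<omega> \<in> E" using E(2) ws by blast
  qed
  finally show ?thesis .
qed

section \<open>The generator while the cat is at a positive site\<close>

lemma total_rate_mm_inf:
  assumes "x \<ge> 1"
  shows "total_rate (mm_inf_rate \<rho>) x = \<rho> + real x"
proof -
  have "total_rate (mm_inf_rate \<rho>) x = infsum (mm_inf_rate \<rho> x) {x - 1, x + 1}"
    unfolding total_rate_def using assms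
    by (intro infsum_cong_neutral) (auto simp: mm_inf_rate_def)
  also have "\<dots> = \<rho> + real x"
    using assms by (auto simp: mm_inf_rate_def)
  finally show ?thesis .
qed

lemma cat_mouse_generator_apart:
  assumes "c \<ge> 1" "c \<noteq> m"
  shows "cat_mouse_generator (mm_inf_rate \<rho>) f (c, m) =
    \<rho> * (f (c + 1, m) - f (c, m)) + real c * (f (c - 1, m) - f (c, m))"
proof -
  have "(\<Sum>\<^sub>\<infinity>z. mm_inf_rate \<rho> c z * (f (z, m) - f (c, m))) =
      infsum (\<lambda>z. mm_inf_rate \<rho> c z * (f (z, m) - f (c, m))) {c - 1, c + 1}"
    using assms by (intro infsum_cong_neutral) (auto simp: mm_inf_rate_def)
  also have "\<dots> = \<rho> * (f (c + 1, m) - f (c, m)) + real c * (f (c - 1, m) - f (c, m))"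
    using assms by (auto simp: mm_inf_rate_def)
  finally show ?thesis using assms by (simp add: cat_mouse_generator_def)
qed

lemma cat_mouse_generator_together:
  assumes "x \<ge> 1" "\<rho> > 0"
  shows "cat_mouse_generator (mm_inf_rate \<rho>) f (x, x) =
    (real x * real x * (f (x - 1, x - 1) - f (x, x)) + real x * \<rho> * (f (x - 1, x + 1) - f (x, x)) +
     \<rho> * real x * (f (x + 1, x - 1) - f (x, x)) + \<rho> * \<rho> * (f (x + 1, x + 1) - f (x, x))) / (\<rho> + real x)"
proof -
  have r: "\<rho> + real x \<noteq> 0" using assms by simp
  let ?g = "\<lambda>(z, z'). total_rate (mm_inf_rate \<rho>) x * jump_prob (mm_inf_rate \<rho>) x z *
      jump_prob (mm_inf_rate \<rho>) x z' * (f (z, z') - f (x, x))"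
  have outside: "jump_prob (mm_inf_rate \<rho>) x z = 0" if "z \<notin> {x - 1, x + 1}" for z
    using that by (auto simp: mm_inf_rate_def jump_prob_def)
  have "(\<Sum>\<^sub>\<infinity>z. ?g z) = infsum ?g ({x - 1, x + 1} \<times> {x - 1, x + 1})"
  proof (intro infsum_cong_neutral)
    fix z assume "z \<in> UNIV - {x - 1, x + 1} \<times> {x - 1, x + 1}"
    then have "fst z \<notin> {x - 1, x + 1} \<or> snd z \<notin> {x - 1, x + 1}"
      unfolding Diff_iff mem_Times_iff by blast
    then have "jump_prob (mm_inf_rate \<rho>) x (fst z) = 0 \<or> jump_prob (mm_inf_rate \<rho>) x (snd z) = 0"
      using outside[of "fst z"] outside[of "snd z"] by argo
    then show "?g z = 0" by (auto simp: case_prod_beta)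
  qed auto
  also have "\<dots> = (\<Sum>z\<in>{x - 1, x + 1}. \<Sum>z'\<in>{x - 1, x + 1}. ?g (z, z'))"
    by (subst infsum_finite) (auto simp: sum.cartesian_product)
  also have "\<dots> = ?g (x - 1, x - 1) + ?g (x - 1, x + 1) + ?g (x + 1, x - 1) + ?g (x + 1, x + 1)"
    by simp
  also have "\<dots> = real x * real x / (\<rho> + real x) * (f (x - 1, x - 1) - f (x, x)) +
      real x * \<rho> / (\<rho> + real x) * (f (x - 1, x + 1) - f (x, x)) +
      \<rho> * real x / (\<rho> + real x) * (f (x + 1, x - 1) - f (x, x)) +
      \<rho> * \<rho> / (\<rho> + real x) * (f (x + 1, x + 1) - f (x, x))"
    using r assms by (auto simp: total_rate_mm_inf jump_prob_def mm_inf_rate_def)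
  finally show ?thesis using assms
    by (simp add: cat_mouse_generator_def add_divide_distrib)
qed

lemma cat_mouse_generator_diff:
  assumes "c \<ge> 1" "\<rho> > 0"
  shows "cat_mouse_generator (mm_inf_rate \<rho>) (\<lambda>z. f z - a * g z) (c, m) =
    cat_mouse_generator (mm_inf_rate \<rho>) f (c, m) - a * cat_mouse_generator (mm_inf_rate \<rho>) g (c, m)"
proof (cases "c = m")
  case True
  show ?thesis
    unfolding True[symmetric] cat_mouse_generator_together[OF assms]
    by (simp add: diff_divide_distrib[symmetric] add_divide_distrib[symmetric] algebra_simps)
next
  case False
  then show ?thesis using assms by (simp add: cat_mouse_generator_apart algebra_simps)
qed

text \<open>
  From a state of the box the process can only step into the box enlarged by one, so a function
  may be cut off outside without changing the generator inside.
\<close>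

lemma cat_mouse_generator_cong:
  assumes "1 \<le> c" "c \<le> R" "m \<le> R" "\<rho> > 0"
    and "\<And>c' m'. c' \<le> R + 1 \<Longrightarrow> m' \<le> R + 1 \<Longrightarrow> f (c', m') = g (c', m')"
  shows "cat_mouse_generator (mm_inf_rate \<rho>) f (c, m) = cat_mouse_generator (mm_inf_rate \<rho>) g (c, m)"
proof (cases "c = m")
  case True
  have "f (c', m') = g (c', m')" if "c' \<in> {c - 1, c, c + 1}" "m' \<in> {c - 1, c, c + 1}" for c' m'
    using that assms(2) by (intro assms(5)) auto
  then show ?thesis
    unfolding True[symmetric] cat_mouse_generator_together[OF assms(1,4)] by simp
next
  case False
  have "f (c', m) = g (c', m)" if "c' \<in> {c - 1, c, c + 1}" for c'
    using that assms(2,3) by (intro assms(5)) auto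
  then show ?thesis using cat_mouse_generator_apart[OF assms(1) False] by simp
qed

section \<open>A Lyapunov function\<close>

text \<open>
  The increments \<open>fact j / \<rho> ^ j\<close> are those of the scale function of the \<open>M/M/\<infinity>\<close> queue, whose
  drift vanishes. The decreasing factor \<open>1 + 1 / real (j + 1)\<close> makes the drift strictly negative
  while keeping the sum unbounded: one function then both rules out escape to infinity and
  supplies the strict sign that optional stopping requires.
\<close>

definition lyapunov :: "real \<Rightarrow> nat \<Rightarrow> real" where
  "lyapunov \<rho> c = (\<Sum>j<c. fact j / \<rho> ^ j * (1 + 1 / real (j + 1)))"

lemma lyapunov_Suc: "lyapunov \<rho> (Suc c) = lyapunov \<rho> c + fact c / \<rho> ^ c * (1 + 1 / real (c + 1))"
  by (simp add: lyapunov_def)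

lemma lyapunov_nonneg: "\<rho> > 0 \<Longrightarrow> lyapunov \<rho> c \<ge> 0"
  unfolding lyapunov_def by (intro sum_nonneg) auto

lemma lyapunov_drift:
  assumes "x \<ge> 1" "\<rho> > 0"
  shows "\<rho> * (lyapunov \<rho> (x + 1) - lyapunov \<rho> x) + real x * (lyapunov \<rho> (x - 1) - lyapunov \<rho> x) < 0"
proof -
  obtain y where y: "x = Suc y" using assms by (cases x) auto
  define A B where "A = fact x / \<rho> ^ x" and "B = fact y / \<rho> ^ y"
  have AB: "\<rho> * A = real x * B" using assms by (simp add: A_def B_def y field_simps)
  have "lyapunov \<rho> (x + 1) - lyapunov \<rho> x = A * (1 + 1 / real (x + 1))"
    by (simp add: lyapunov_Suc A_def)
  moreover have "lyapunov \<rho> (x - 1) - lyapunov \<rho> x = - (B * (1 + 1 / real x))"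
    by (simp add: y lyapunov_Suc B_def)
  ultimately have "\<rho> * (lyapunov \<rho> (x + 1) - lyapunov \<rho> x) + real x * (lyapunov \<rho> (x - 1) - lyapunov \<rho> x)
      = (\<rho> * A) * (1 + 1 / real (x + 1)) - (real x * B) * (1 + 1 / real x)"
    by simp
  also have "\<dots> = real x * B * (1 / real (x + 1) - 1 / real x)"
    unfolding AB by (simp add: algebra_simps)
  also have "\<dots> < 0"
    using assms by (intro mult_pos_neg mult_pos_pos) (auto simp: B_def y intro!: divide_strict_left_mono)
  finally show ?thesis .
qed

text \<open>
  When cat and mouse are together, each of them moves with the rates of the queue, and a sum of
  functions of the two coordinates sees only these marginals.
\<close>

lemma cat_mouse_lyapunov_drift:
  assumes "c \<ge> 1" "\<rho> > 0"
  shows "cat_mouse_generator (mm_inf_rate \<rho>) (\<lambda>(c, m). lyapunov \<rho> c + lyapunov \<rho> m) (c, m) < 0"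
proof (cases "c = m")
  case False
  then show ?thesis using lyapunov_drift[OF assms] assms
    by (simp add: cat_mouse_generator_apart)
next
  case True
  let ?u = "lyapunov \<rho> (c + 1) - lyapunov \<rho> c" and ?d = "lyapunov \<rho> (c - 1) - lyapunov \<rho> c"
  have "cat_mouse_generator (mm_inf_rate \<rho>) (\<lambda>(c, m). lyapunov \<rho> c + lyapunov \<rho> m) (c, m)
      = (2 * (\<rho> * ?u + real c * ?d) * (\<rho> + real c)) / (\<rho> + real c)"
    unfolding True[symmetric] cat_mouse_generator_together[OF assms]
    by (intro arg_cong2[where f="(/)"] refl) (simp add: algebra_simps)
  also have "\<dots> = 2 * (\<rho> * ?u + real c * ?d)" using assms by simp
  finally show ?thesis using lyapunov_drift[OF assms] by simp
qed

lemma inverse_lyapunov_tendsto_0: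
  assumes "\<rho> > 0"
  shows "(\<lambda>R. 1 / lyapunov \<rho> (R + 1)) \<longlonglongrightarrow> 0"
proof (rule tendsto_sandwich[of "\<lambda>_. 0"])
  have pos: "lyapunov \<rho> (R + 1) \<ge> fact R / \<rho> ^ R" for R
    using lyapunov_nonneg[OF assms, of R] assms by (simp add: lyapunov_Suc algebra_simps)
  have "1 / lyapunov \<rho> (R + 1) \<le> \<rho> ^ R / fact R" for R
  proof -
    have fact_pos: "0 < fact R / \<rho> ^ R" using assms by simp
    then have "1 / lyapunov \<rho> (R + 1) \<le> 1 / (fact R / \<rho> ^ R)"
      using pos[of R] by (intro divide_left_mono mult_pos_pos) auto
    then show ?thesis by simp
  qed
  then show "\<forall>\<^sub>F R in sequentially. 1 / lyapunov \<rho> (R + 1) \<le> inverse (fact R) * \<rho> ^ R"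
    by (simp add: field_simps)
  show "(\<lambda>R. inverse (fact R) * \<rho> ^ R) \<longlonglongrightarrow> 0"
    by (rule summable_LIMSEQ_zero[OF summable_exp])
qed (use lyapunov_nonneg[OF assms] in auto)

section \<open>Comparison with subharmonic functions\<close>

lemma cadlag_path_fst: "cadlag_path (\<lambda>t. (c t, m t)) \<Longrightarrow> cadlag_path c"
  unfolding cadlag_path_def
proof (elim conjE, intro conjI allI impI)
  assume *: "\<forall>t\<ge>0. \<forall>\<^sub>F s in at_right t. (c s, m s) = (c t, m t)"
  fix t :: real assume "0 \<le> t"
  with * have "\<forall>\<^sub>F s in at_right t. (c s, m s) = (c t, m t)" by blast
  then show "\<forall>\<^sub>F s in at_right t. c s = c t" by eventually_elim simp
next
  assume *: "\<forall>t>0. \<exists>z. \<forall>\<^sub>F s in at_left t. (c s, m s) = z"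
  fix t :: real assume "0 < t"
  with * obtain z where "\<forall>\<^sub>F s in at_left t. (c s, m s) = z" by blast
  then have "\<forall>\<^sub>F s in at_left t. c s = fst z" by eventually_elim auto
  then show "\<exists>z. \<forall>\<^sub>F s in at_left t. c s = z" by blast
qed

text \<open>
  The value \<open>0\<close> on paths whose cat never visits \<open>0\<close> is the one that \<open>enn2real\<close> assigns to an
  infinite hitting time.
\<close>

definition cat_zero_time :: "(real \<Rightarrow> nat \<times> nat) \<Rightarrow> real" where
  "cat_zero_time x = (if \<exists>t\<ge>0. x t \<in> {0} \<times> UNIV then first_time x ({0} \<times> UNIV) else 0)"

lemma hitting_time_eq_cat_zero_time:
  fixes C M :: "real \<Rightarrow> 'a \<Rightarrow> nat"
  assumes "cadlag_path (\<lambda>t. (C t \<omega>, M t \<omega>))"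
  defines "\<sigma> \<equiv> cat_zero_time (\<lambda>t. (C t \<omega>, M t \<omega>))"
  shows "enn2real (hitting_time C 0 \<omega>) = \<sigma>"
    and "hitting_time C 0 \<omega> < \<infinity> \<longleftrightarrow> C \<sigma> \<omega> = 0"
proof -
  have C: "cadlag_path (\<lambda>t. C t \<omega>)" using cadlag_path_fst assms(1) .
  have eq: "first_time (\<lambda>t. (C t \<omega>, M t \<omega>)) ({0} \<times> UNIV) = first_time (\<lambda>t. C t \<omega>) {0}"
    by (simp add: first_time_def)
  note ht = hitting_time_eq_first_time[where X=C and \<omega>=\<omega> and z=0, OF C]
  show "enn2real (hitting_time C 0 \<omega>) = \<sigma>"
  proof (cases "\<exists>t\<ge>0. C t \<omega> = 0")
    case True
    then obtain t where "0 \<le> t" "C t \<omega> \<in> {0}" by auto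
    with True show ?thesis unfolding ht \<sigma>_def cat_zero_time_def eq
      using first_time_nonneg[of t "\<lambda>t. C t \<omega>" "{0}"] by simp
  qed (auto simp: ht \<sigma>_def cat_zero_time_def)
  show "hitting_time C 0 \<omega> < \<infinity> \<longleftrightarrow> C \<sigma> \<omega> = 0"
  proof (cases "\<exists>t\<ge>0. C t \<omega> = 0")
    case True
    then obtain t where "0 \<le> t" "C t \<omega> \<in> {0}" by auto
    with True show ?thesis unfolding ht \<sigma>_def cat_zero_time_def eq
      using first_time_attained[where x="\<lambda>t. C t \<omega>" and t=t and K="{0}", OF C] by simp
  qed (auto simp: ht \<sigma>_def cat_zero_time_def)
qed

lemma measurable_at_hitting_time:
  fixes C M :: "real \<Rightarrow> 'a \<Rightarrow> nat" and v :: "nat \<times> nat \<Rightarrow> real"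
  assumes "markov_process_with_generator \<mu> (\<lambda>t \<omega>. (C t \<omega>, M t \<omega>)) L"
  shows "(\<lambda>\<omega>. v (C (enn2real (hitting_time C 0 \<omega>)) \<omega>, M (enn2real (hitting_time C 0 \<omega>)) \<omega>))
    \<in> borel_measurable \<mu>"
proof -
  let ?X = "\<lambda>t \<omega>. (C t \<omega>, M t \<omega>)"
  from assms have X: "\<And>t. t \<ge> 0 \<Longrightarrow> ?X t \<in> measurable \<mu> (count_space UNIV)"
    and path: "\<And>\<omega>. \<omega> \<in> space \<mu> \<Longrightarrow> cadlag_path (\<lambda>t. ?X t \<omega>)"
    unfolding markov_process_with_generator_def by blast+
  have "(\<lambda>\<omega>. v (?X (if \<exists>t\<ge>0. ?X t \<omega> \<in> {0} \<times> UNIV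
          then first_time (\<lambda>t. ?X t \<omega>) ({0} \<times> UNIV) else 0) \<omega>)) \<in> borel_measurable \<mu>"
    by (rule measurable_at_first_time[where X="?X", OF X path])
  then show ?thesis
  proof (rule measurable_cong[THEN iffD1, rotated])
    fix \<omega> assume "\<omega> \<in> space \<mu>"
    then show "v (?X (if \<exists>t\<ge>0. ?X t \<omega> \<in> {0} \<times> UNIV
          then first_time (\<lambda>t. ?X t \<omega>) ({0} \<times> UNIV) else 0) \<omega>) =
        v (C (enn2real (hitting_time C 0 \<omega>)) \<omega>, M (enn2real (hitting_time C 0 \<omega>)) \<omega>)"
      using hitting_time_eq_cat_zero_time(1)[where C=C and M=M and \<omega>=\<omega>, OF path]
      by (simp add: cat_zero_time_def)
  qed
qed

text \<open>
  The cat sits at \<open>0\<close> at the truncated hitting time exactly if the hitting time is finite, so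
  the event is read off from the state at that time.
\<close>

lemma hitting_event_measurable:
  fixes C M :: "real \<Rightarrow> 'a \<Rightarrow> nat"
  assumes "markov_process_with_generator \<mu> (\<lambda>t \<omega>. (C t \<omega>, M t \<omega>)) L"
  shows "{\<omega>\<in>space \<mu>. hitting_time C 0 \<omega> < \<infinity> \<and> M (enn2real (hitting_time C 0 \<omega>)) \<omega> \<in> A} \<in> sets \<mu>"
proof -
  have path: "\<And>\<omega>. \<omega> \<in> space \<mu> \<Longrightarrow> cadlag_path (\<lambda>t. (C t \<omega>, M t \<omega>))"
    using assms unfolding markov_process_with_generator_def by blast
  let ?v = "\<lambda>z. of_bool (fst z = 0 \<and> snd z \<in> A) :: real"
  let ?T = "\<lambda>\<omega>. enn2real (hitting_time C 0 \<omega>)"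
  define g where "g \<omega> = ?v (C (?T \<omega>) \<omega>, M (?T \<omega>) \<omega>)" for \<omega>
  have "g \<in> borel_measurable \<mu>"
    unfolding g_def by (rule measurable_at_hitting_time[OF assms])
  moreover have "{1 :: real} \<in> sets borel" by simp
  ultimately have "g -` {1} \<inter> space \<mu> \<in> sets \<mu>" by (rule measurable_sets)
  also have "g -` {1} \<inter> space \<mu> =
      {\<omega>\<in>space \<mu>. hitting_time C 0 \<omega> < \<infinity> \<and> M (?T \<omega>) \<omega> \<in> A}"
    using hitting_time_eq_cat_zero_time[where C=C and M=M, OF path] by (auto simp: g_def)
  finally show ?thesis .
qed

text \<open>
  The comparison principle: a subharmonic function bounded by \<open>1\<close>, and by the indicator of \<open>A\<close>
  when the cat is at \<open>0\<close>, is a lower bound for the probability that the mouse is in \<open>A\<close> when the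
  cat reaches \<open>0\<close>. Subtracting a small multiple of the Lyapunov function makes the drift strictly
  positive in a box and the function nonpositive on the far sides of the box, so that only exits
  through the cat reaching \<open>0\<close> count. The multiple tends to \<open>0\<close> as the box grows.
\<close>

lemma subharmonic_lower_bound:
  fixes C M :: "real \<Rightarrow> 'a \<Rightarrow> nat" and f :: "nat \<times> nat \<Rightarrow> real"
  assumes process: "markov_process_with_generator \<mu> (\<lambda>t \<omega>. (C t \<omega>, M t \<omega>))
      (cat_mouse_generator (mm_inf_rate \<rho>))"
    and \<rho>: "\<rho> > 0" and "n \<ge> 1"
    and init: "AE \<omega> in \<mu>. C 0 \<omega> = n \<and> M 0 \<omega> = n"
    and le_1: "\<And>c m. f (c, m) \<le> 1"
    and boundary: "\<And>m. f (0, m) \<le> indicator A m"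
    and subharmonic: "\<And>c m. c \<ge> 1 \<Longrightarrow> 0 \<le> cat_mouse_generator (mm_inf_rate \<rho>) f (c, m)"
  shows "f (n, n) \<le> measure \<mu>
    {\<omega>\<in>space \<mu>. hitting_time C 0 \<omega> < \<infinity> \<and> M (enn2real (hitting_time C 0 \<omega>)) \<omega> \<in> A}"
    (is "_ \<le> measure \<mu> ?E")
proof -
  let ?L = "cat_mouse_generator (mm_inf_rate \<rho>)"
  let ?h = "\<lambda>(c, m). lyapunov \<rho> c + lyapunov \<rho> m"
  have path: "\<And>\<omega>. \<omega> \<in> space \<mu> \<Longrightarrow> cadlag_path (\<lambda>t. (C t \<omega>, M t \<omega>))"
    using process unfolding markov_process_with_generator_def by blast
  have bound: "f (n, n) - 1 / lyapunov \<rho> (R + 1) * (2 * lyapunov \<rho> n) \<le> measure \<mu> ?E" if "R \<ge> n" for R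
  proof -
    \<comment> \<open>With this multiple the Lyapunov term is at least \<open>1\<close> as soon as one
      coordinate equals \<open>R + 1\<close>.\<close>
    define a where "a = 1 / lyapunov \<rho> (R + 1)"
    have lyap_pos: "lyapunov \<rho> (R + 1) > 0"
    proof -
      have "0 < fact R / \<rho> ^ R * (1 + 1 / real (R + 1))"
        using \<rho> by (intro mult_pos_pos add_pos_pos) auto
      then show ?thesis using lyapunov_nonneg[OF \<rho>, of R] lyapunov_Suc[of \<rho> R]
        unfolding Suc_eq_plus1 by linarith
    qed
    then have a: "a > 0" "a * lyapunov \<rho> (R + 1) = 1" by (auto simp: a_def)
    define g where "g = (\<lambda>(c, m). if c \<le> R + 1 \<and> m \<le> R + 1 then f (c, m) - a * ?h (c, m) else 0)"
    have "g (n, n) \<le> measure \<mu> ?E"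
    proof (rule exit_probability_bound[where S="{1..R} \<times> {..R}" and D="{0} \<times> A", OF process])
      show "AE \<omega> in \<mu>. (C 0 \<omega>, M 0 \<omega>) = (n, n)" using init by simp
      show "(n, n) \<in> {1..R} \<times> {..R}" using that \<open>n \<ge> 1\<close> by simp
      show "finite {x. g x \<noteq> 0}"
        by (rule finite_subset[of _ "{..R + 1} \<times> {..R + 1}"]) (auto simp: g_def split: if_splits)
      show "0 < ?L g x" if x_in: "x \<in> {1..R} \<times> {..R}" for x
      proof -
        obtain c m where x: "x = (c, m)" "1 \<le> c" "c \<le> R" "m \<le> R" using x_in by (cases x) auto
        have "?L g (c, m) = ?L (\<lambda>z. f z - a * ?h z) (c, m)"
          using x \<rho> by (intro cat_mouse_generator_cong) (auto simp: g_def)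
        also have "\<dots> = ?L f (c, m) - a * ?L ?h (c, m)"
          using x \<rho> by (intro cat_mouse_generator_diff)
        also have "\<dots> > 0"
          using subharmonic[of c m] mult_pos_neg[OF a(1) cat_mouse_lyapunov_drift[OF x(2) \<rho>, of m]] x
          by linarith
        finally show ?thesis by (simp only: x)
      qed
      show "g x \<le> indicator ({0} \<times> A) x" if x_out: "x \<notin> {1..R} \<times> {..R}" for x
      proof -
        obtain c m where x: "x = (c, m)" by fastforce
        have h: "0 \<le> a * lyapunov \<rho> c" "0 \<le> a * lyapunov \<rho> m"
          using a(1) lyapunov_nonneg[OF \<rho>] by auto
        consider "c > R + 1 \<or> m > R + 1" | "c = 0" | "c = R + 1" "m \<le> R + 1" | "m = R + 1" "c \<le> R + 1"
          using x_out x by fastforce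
        then show ?thesis
        proof cases
          case 1
          then show ?thesis by (auto simp: g_def x)
        next
          case 2
          then show ?thesis using boundary[of m] h by (auto simp: g_def x indicator_def distrib_left)
        next
          case 3
          then have "g x \<le> 0" using le_1[of c m] h a(2) by (simp add: g_def x distrib_left)
          then show ?thesis by (rule order_trans) simp
        next
          case 4
          then have "g x \<le> 0" using le_1[of c m] h a(2) by (simp add: g_def x distrib_left)
          then show ?thesis by (rule order_trans) simp
        qed
      qed
      show "?E \<in> sets \<mu>" by (rule hitting_event_measurable[OF process])
      show "{\<omega> \<in> space \<mu>. \<exists>t\<ge>0. (C t \<omega>, M t \<omega>) \<in> {0} \<times> A \<and>
          (\<forall>u\<ge>0. u < t \<longrightarrow> (C u \<omega>, M u \<omega>) \<in> {1..R} \<times> {..R})} \<subseteq> ?E"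
      proof
        fix \<omega>
        assume "\<omega> \<in> {\<omega> \<in> space \<mu>. \<exists>t\<ge>0. (C t \<omega>, M t \<omega>) \<in> {0} \<times> A \<and>
          (\<forall>u\<ge>0. u < t \<longrightarrow> (C u \<omega>, M u \<omega>) \<in> {1..R} \<times> {..R})}"
        then obtain t where w: "\<omega> \<in> space \<mu>" and t: "0 \<le> t" "C t \<omega> = 0" "M t \<omega> \<in> A"
          and before: "\<And>u. 0 \<le> u \<Longrightarrow> u < t \<Longrightarrow> C u \<omega> \<noteq> 0"
          by fastforce
        let ?\<tau> = "first_time (\<lambda>t. C t \<omega>) {0}"
        have C: "cadlag_path (\<lambda>t. C t \<omega>)" using cadlag_path_fst path[OF w] .
        have "0 \<le> ?\<tau>" "?\<tau> \<le> t" "C ?\<tau> \<omega> = 0"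
          using t first_time_nonneg[of t "\<lambda>t. C t \<omega>" "{0}"] first_time_le[of t "\<lambda>t. C t \<omega>" "{0}"]
            first_time_attained[where x="\<lambda>t. C t \<omega>" and t=t and K="{0}", OF C] by auto
        with before[of ?\<tau>] have "?\<tau> = t" by linarith
        moreover have "\<exists>t\<ge>0. C t \<omega> = 0" using t by auto
        ultimately have "hitting_time C 0 \<omega> = ennreal t"
          using hitting_time_eq_first_time[where X=C and \<omega>=\<omega> and z=0, OF C] by simp
        then show "\<omega> \<in> ?E" using t w by auto
      qed
      show "finite ({1..R} \<times> {..R})" by simp
      show "({0} \<times> A) \<inter> ({1..R} \<times> {..R}) = {}" by auto
    qed
    also have "g (n, n) = f (n, n) - a * (2 * lyapunov \<rho> n)"
      using that by (simp add: g_def)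
    finally show ?thesis by (simp only: a_def)
  qed
  have "(\<lambda>R. f (n, n) - 1 / lyapunov \<rho> (R + 1) * (2 * lyapunov \<rho> n))
      \<longlonglongrightarrow> f (n, n) - 0 * (2 * lyapunov \<rho> n)"
    by (intro tendsto_intros inverse_lyapunov_tendsto_0[OF \<rho>])
  then have "f (n, n) - 0 * (2 * lyapunov \<rho> n) \<le> measure \<mu> ?E"
    by (rule LIMSEQ_le_const2) (use bound in blast)
  then show ?thesis by simp
qed

section \<open>The scale function\<close>

text \<open>
  The scale function of the \<open>M/M/\<infinity>\<close> queue: for \<open>a \<le> b\<close>, the queue started at \<open>a\<close> reaches \<open>b\<close>
  before \<open>0\<close> with probability \<open>scale_sum \<rho> a / scale_sum \<rho> b\<close>.
\<close>

definition scale_sum :: "real \<Rightarrow> nat \<Rightarrow> real" where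
  "scale_sum \<rho> c = (\<Sum>j<c. fact j / \<rho> ^ j)"

lemma scale_sum_0 [simp]: "scale_sum \<rho> 0 = 0"
  by (simp add: scale_sum_def)

lemma scale_sum_Suc: "scale_sum \<rho> (Suc c) = scale_sum \<rho> c + fact c / \<rho> ^ c"
  by (simp add: scale_sum_def)

lemma scale_sum_mono: "\<rho> > 0 \<Longrightarrow> c \<le> d \<Longrightarrow> scale_sum \<rho> c \<le> scale_sum \<rho> d"
  unfolding scale_sum_def by (intro sum_mono2) auto

lemma scale_sum_nonneg: "\<rho> > 0 \<Longrightarrow> scale_sum \<rho> c \<ge> 0"
  using scale_sum_mono[of \<rho> 0 c] by simp

lemma scale_sum_pos: "\<rho> > 0 \<Longrightarrow> c \<ge> 1 \<Longrightarrow> scale_sum \<rho> c > 0"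
  using scale_sum_mono[of \<rho> 1 c] by (simp add: scale_sum_def)

lemma scale_sum_harmonic:
  assumes "x \<ge> 1" "\<rho> > 0"
  shows "\<rho> * (scale_sum \<rho> (x + 1) - scale_sum \<rho> x) + real x * (scale_sum \<rho> (x - 1) - scale_sum \<rho> x) = 0"
proof -
  obtain y where y: "x = Suc y" using assms by (cases x) auto
  have "\<rho> * (fact x / \<rho> ^ x) = real x * (fact y / \<rho> ^ y)"
    using assms by (simp add: y field_simps)
  moreover have "scale_sum \<rho> (x + 1) - scale_sum \<rho> x = fact x / \<rho> ^ x" by (simp add: scale_sum_Suc)
  moreover have "scale_sum \<rho> (x - 1) - scale_sum \<rho> x = - (fact y / \<rho> ^ y)" by (simp add: y scale_sum_Suc)
  ultimately show ?thesis by simp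
qed

text \<open>
  The scale function relative to its next increment. It is an upper bound for the probability
  that the queue climbs from \<open>x - 1\<close> to \<open>x + 1\<close> before emptying, and it will be the error term in
  the lower bound for the distribution function.
\<close>

definition scale_ratio :: "real \<Rightarrow> nat \<Rightarrow> real" where
  "scale_ratio \<rho> x = scale_sum \<rho> x / (fact x / \<rho> ^ x)"

lemma scale_ratio_Suc:
  assumes "\<rho> > 0"
  shows "scale_ratio \<rho> (Suc x) = \<rho> / real (x + 1) * (scale_ratio \<rho> x + 1)"
proof -
  define A where "A = fact x / \<rho> ^ x"
  have "A > 0" using assms by (simp add: A_def)
  have "fact (Suc x) / \<rho> ^ Suc x = real (x + 1) / \<rho> * A" by (simp add: A_def)
  then show ?thesis
    using \<open>A > 0\<close> assms unfolding scale_ratio_def scale_sum_Suc A_def[symmetric]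
    by (simp add: divide_simps)
qed

lemma scale_ratio_nonneg: "\<rho> > 0 \<Longrightarrow> scale_ratio \<rho> x \<ge> 0"
  unfolding scale_ratio_def using scale_sum_nonneg by simp

text \<open>
  The factor of the recursion is at most \<open>1 / 2\<close> from \<open>2 * \<rho>\<close> on, so the ratios are bounded; one
  more use of the recursion gains the factor \<open>1 / x\<close>.
\<close>

lemma scale_ratio_bound:
  assumes "\<rho> > 0"
  obtains K N where "\<And>x. x \<ge> N \<Longrightarrow> real x * scale_ratio \<rho> x \<le> K"
proof -
  define N where "N = nat \<lceil>2 * \<rho>\<rceil>"
  have N: "2 * \<rho> \<le> real N" unfolding N_def by linarith
  define B where "B = max 1 (scale_ratio \<rho> N)"
  have B: "scale_ratio \<rho> x \<le> B" if "x \<ge> N" for x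
    using that
  proof (induction x rule: dec_induct)
    case (step x)
    have "\<rho> / real (x + 1) \<le> 1 / 2" using N step(1) by (simp add: field_simps)
    then have "scale_ratio \<rho> (Suc x) \<le> 1 / 2 * (scale_ratio \<rho> x + 1)"
      unfolding scale_ratio_Suc[OF assms] using scale_ratio_nonneg[OF assms, of x]
      by (intro mult_right_mono) auto
    also have "\<dots> \<le> B" using step(3) by (simp add: B_def)
    finally show ?case .
  qed (simp add: B_def)
  show ?thesis
  proof (rule that[of "Suc N" "\<rho> * (B + 1)"])
    fix x assume "Suc N \<le> x"
    then obtain y where y: "x = Suc y" "y \<ge> N" by (cases x) auto
    have "real x * scale_ratio \<rho> x = \<rho> * (scale_ratio \<rho> y + 1)"
      unfolding y(1) scale_ratio_Suc[OF assms] by simp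
    also have "\<dots> \<le> \<rho> * (B + 1)" using B[OF y(2)] assms by simp
    finally show "real x * scale_ratio \<rho> x \<le> \<rho> * (B + 1)" .
  qed
qed

lemma scale_ratio_tendsto_0:
  assumes "\<rho> > 0"
  shows "scale_ratio \<rho> \<longlonglongrightarrow> 0"
proof -
  obtain K N where K: "\<And>x. x \<ge> N \<Longrightarrow> real x * scale_ratio \<rho> x \<le> K"
    using scale_ratio_bound[OF assms] by blast
  show ?thesis
  proof (rule tendsto_sandwich[of "\<lambda>_. 0" _ _ "\<lambda>x. K / real x"])
    show "\<forall>\<^sub>F x in sequentially. scale_ratio \<rho> x \<le> K / real x"
      using eventually_ge_at_top[of "max N 1"]
      by eventually_elim (use K in \<open>auto simp: field_simps\<close>)
    show "(\<lambda>x. K / real x) \<longlonglongrightarrow> 0" by real_asymp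
  qed (use scale_ratio_nonneg[OF assms] in auto)
qed

lemma excursion_prob_le_scale_ratio:
  assumes "\<rho> > 0"
  shows "scale_sum \<rho> (x - 1) / scale_sum \<rho> (x + 1) \<le> scale_ratio \<rho> x"
  unfolding scale_ratio_def
proof (rule frac_le)
  show "scale_sum \<rho> (x - 1) \<le> scale_sum \<rho> x" using assms by (intro scale_sum_mono) auto
  show "fact x / \<rho> ^ x \<le> scale_sum \<rho> (x + 1)" using scale_sum_nonneg[OF assms] by (simp add: scale_sum_Suc)
qed (use assms scale_sum_nonneg in auto)

section \<open>The profile of the hitting distribution\<close>

text \<open>
  An approximation to the probability, from the state \<open>(c, m)\<close>, that the mouse is at most at \<open>k\<close>
  when the cat reaches \<open>0\<close>. If \<open>m > k\<close>, the cat must first find the mouse, otherwise the mouse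
  remains at \<open>m\<close>; a cat above the mouse finds it surely, a cat below with the probability given
  by the scale function. For a meeting at \<open>m\<close> the value is \<open>(k / m) powr \<theta>\<close>: each level is
  passed with probability \<open>m / (m + \<rho>)\<close>, and \<open>(k / m) powr \<rho>\<close> is the order of the product of
  these factors. The exponent \<open>\<theta>\<close> is kept free because the upper bound needs some slack.
\<close>

definition profile :: "real \<Rightarrow> nat \<Rightarrow> real \<Rightarrow> nat \<times> nat \<Rightarrow> real" where
  "profile \<rho> k \<theta> = (\<lambda>(c, m). if m \<le> k then 1
     else (real k / real m) powr \<theta> * (scale_sum \<rho> (min c m) / scale_sum \<rho> m))"

lemma profile_cat_above:
  assumes "\<rho> > 0" "k \<ge> 1" "k \<le> m" "m \<le> c"
  shows "profile \<rho> k \<theta> (c, m) = (real k / real m) powr \<theta>"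
proof (cases "m = k")
  case False
  then show ?thesis using assms scale_sum_pos[of \<rho> m] by (simp add: profile_def)
qed (use assms in \<open>simp add: profile_def\<close>)

lemma profile_bounds:
  assumes "\<rho> > 0" "\<theta> > 0"
  shows "0 \<le> profile \<rho> k \<theta> (c, m)" "profile \<rho> k \<theta> (c, m) \<le> 1"
proof -
  have "(real k / real m) powr \<theta> \<le> 1" if "k < m"
    using that assms by (intro powr_le1) auto
  moreover have "scale_sum \<rho> (min c m) / scale_sum \<rho> m \<le> 1" if "k < m"
    using that assms scale_sum_pos[of \<rho> m] scale_sum_mono[of \<rho> "min c m" m] by simp
  moreover have "0 \<le> scale_sum \<rho> (min c m) / scale_sum \<rho> m"
    using scale_sum_nonneg[OF assms(1)] by simp
  ultimately show "profile \<rho> k \<theta> (c, m) \<le> 1"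
    unfolding profile_def by (auto simp del: times_divide_eq_right intro: mult_le_one)
  show "0 \<le> profile \<rho> k \<theta> (c, m)"
    using scale_sum_nonneg[OF assms(1)] by (auto simp: profile_def)
qed

lemma profile_generator_apart:
  assumes "\<rho> > 0" "c \<ge> 1" "c \<noteq> m"
  shows "cat_mouse_generator (mm_inf_rate \<rho>) (profile \<rho> k \<theta>) (c, m) = 0"
proof (cases "c < m \<and> k < m")
  case True
  define a where "a = (real k / real m) powr \<theta> / scale_sum \<rho> m"
  have p: "profile \<rho> k \<theta> (c', m) = a * scale_sum \<rho> c'" if "c' \<le> m" for c'
    using that True by (simp add: profile_def a_def min_def)
  have "cat_mouse_generator (mm_inf_rate \<rho>) (profile \<rho> k \<theta>) (c, m)
      = a * (\<rho> * (scale_sum \<rho> (c + 1) - scale_sum \<rho> c) + real c * (scale_sum \<rho> (c - 1) - scale_sum \<rho> c))"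
    using True assms by (subst cat_mouse_generator_apart) (auto simp: p algebra_simps)
  then show ?thesis using scale_sum_harmonic[of c \<rho>] assms by simp
next
  case False
  then have "profile \<rho> k \<theta> (c', m) = profile \<rho> k \<theta> (c, m)" if "c' \<in> {c - 1, c + 1}" for c'
  proof -
    have "m \<le> k \<or> m \<le> c' \<and> m \<le> c" using that False assms(3) by auto
    then show ?thesis by (auto simp: profile_def min_absorb2)
  qed
  then show ?thesis using assms by (subst cat_mouse_generator_apart) auto
qed

lemma profile_generator_below:
  assumes "\<rho> > 0" "x \<ge> 1" "x < k"
  shows "cat_mouse_generator (mm_inf_rate \<rho>) (profile \<rho> k \<theta>) (x, x) = 0"
proof -
  have "profile \<rho> k \<theta> (c, m) = 1" if "m \<le> x + 1" for c m
    using that assms by (simp add: profile_def)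
  then show ?thesis using assms by (subst cat_mouse_generator_together) auto
qed

text \<open>
  The level \<open>k\<close> is the only meeting site where the profile has the wrong sign of drift for the
  lower bound: an upward step of the mouse leaves the region where the profile is \<open>1\<close>.
\<close>

lemma profile_generator_at_level:
  assumes "\<rho> > 0" "k \<ge> 1" "\<theta> > 0"
  shows "- \<rho> \<le> cat_mouse_generator (mm_inf_rate \<rho>) (profile \<rho> k \<theta>) (k, k)"
    and "cat_mouse_generator (mm_inf_rate \<rho>) (profile \<rho> k \<theta>) (k, k) \<le> 0"
proof -
  define u v where "u = profile \<rho> k \<theta> (k - 1, k + 1)" and "v = profile \<rho> k \<theta> (k + 1, k + 1)"
  have uv: "0 \<le> u" "u \<le> 1" "0 \<le> v" "v \<le> 1"
    unfolding u_def v_def using profile_bounds[of \<rho> \<theta>] assms by blast+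
  have one: "profile \<rho> k \<theta> (c, m) = 1" if "m \<le> k" for c m
    using that by (simp add: profile_def)
  have eq: "cat_mouse_generator (mm_inf_rate \<rho>) (profile \<rho> k \<theta>) (k, k)
      = \<rho> * (real k * (u - 1) + \<rho> * (v - 1)) / (\<rho> + real k)"
    using assms by (subst cat_mouse_generator_together)
      (simp_all add: one u_def v_def algebra_simps)
  have "- (\<rho> + real k) \<le> real k * (u - 1) + \<rho> * (v - 1)"
    using uv assms by (simp add: algebra_simps add_nonneg_nonneg)
  then have "\<rho> * - (\<rho> + real k) \<le> \<rho> * (real k * (u - 1) + \<rho> * (v - 1))"
    using assms by (intro mult_left_mono) auto
  then have "- \<rho> * (\<rho> + real k) \<le> \<rho> * (real k * (u - 1) + \<rho> * (v - 1))"
    by (simp only: mult_minus_left mult_minus_right)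
  then show "- \<rho> \<le> cat_mouse_generator (mm_inf_rate \<rho>) (profile \<rho> k \<theta>) (k, k)"
    unfolding eq using assms(1) by (subst pos_le_divide_eq) auto
  have "real k * (u - 1) + \<rho> * (v - 1) \<le> 0"
    using uv assms by (intro add_nonpos_nonpos mult_nonneg_nonpos) auto
  then show "cat_mouse_generator (mm_inf_rate \<rho>) (profile \<rho> k \<theta>) (k, k) \<le> 0"
    unfolding eq using assms by (intro divide_nonpos_pos mult_nonneg_nonpos) auto
qed

lemma profile_generator_above:
  assumes "\<rho> > 0" "k \<ge> 1" "\<theta> > 0" "k < x"
  shows "cat_mouse_generator (mm_inf_rate \<rho>) (profile \<rho> k \<theta>) (x, x) * (\<rho> + real x) =
    real x * (\<rho> + real x) * (real k / real (x - 1)) powr \<theta>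
    + \<rho> * (real x * (scale_sum \<rho> (x - 1) / scale_sum \<rho> (x + 1)) + \<rho>) * (real k / real (x + 1)) powr \<theta>
    - (\<rho> + real x) * (\<rho> + real x) * (real k / real x) powr \<theta>"
proof -
  define a b d r where "a = (real k / real (x - 1)) powr \<theta>" and "b = (real k / real (x + 1)) powr \<theta>"
    and "d = (real k / real x) powr \<theta>" and "r = scale_sum \<rho> (x - 1) / scale_sum \<rho> (x + 1)"
  have v: "profile \<rho> k \<theta> (x - 1, x - 1) = a" "profile \<rho> k \<theta> (x + 1, x - 1) = a"
    "profile \<rho> k \<theta> (x + 1, x + 1) = b" "profile \<rho> k \<theta> (x, x) = d"
    unfolding a_def b_def d_def using assms by (intro profile_cat_above; linarith)+
  have u: "profile \<rho> k \<theta> (x - 1, x + 1) = b * r"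
    using assms by (simp add: profile_def b_def r_def)
  have pos: "\<rho> + real x \<noteq> 0" "1 \<le> x" using assms by auto
  show ?thesis
    unfolding a_def[symmetric] b_def[symmetric] d_def[symmetric] r_def[symmetric]
      cat_mouse_generator_together[OF pos(2) assms(1)] v u nonzero_divide_eq_eq[OF pos(1)]
      times_divide_eq_left nonzero_mult_div_cancel_right[OF pos(1)]
    by (simp add: algebra_simps)
qed

lemma cat_mouse_generator_mouse_only:
  assumes "x \<ge> 1" "\<rho> > 0"
  shows "cat_mouse_generator (mm_inf_rate \<rho>) (\<lambda>(c, m). g m) (x, x) =
    \<rho> * (g (x + 1) - g x) + real x * (g (x - 1) - g x)"
proof -
  have "cat_mouse_generator (mm_inf_rate \<rho>) (\<lambda>(c, m). g m) (x, x)
      = (\<rho> * (g (x + 1) - g x) + real x * (g (x - 1) - g x)) * (\<rho> + real x) / (\<rho> + real x)"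
    unfolding cat_mouse_generator_together[OF assms]
    by (intro arg_cong2[where f="(/)"] refl) (simp add: algebra_simps)
  then show ?thesis using assms by simp
qed

text \<open>
  Discarding the nonnegative contributions of upward steps of the mouse, it suffices that
  \<open>(1 + \<rho> / x) * ((x - 1) / x) powr \<rho> \<le> 1\<close>. This follows from \<open>1 + u \<le> exp u\<close> and
  \<open>ln y \<le> y - 1\<close>.
\<close>

lemma profile_subharmonic_above:
  assumes "\<rho> > 0" "k \<ge> 1" "k < x"
  shows "0 \<le> cat_mouse_generator (mm_inf_rate \<rho>) (profile \<rho> k \<rho>) (x, x)"
proof -
  define a where "a = (real k / real (x - 1)) powr \<rho>"
  have x: "real x > 1" "real (x - 1) = real x - 1" using assms by auto
  have "(real x - 1) / real x = 1 - 1 / real x" using x by (simp add: field_simps)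
  then have "ln ((real x - 1) / real x) \<le> - 1 / real x"
    using ln_le_minus_one[of "(real x - 1) / real x"] x by simp
  then have "\<rho> * ln ((real x - 1) / real x) \<le> \<rho> * (- 1 / real x)"
    using assms(1) by (intro mult_left_mono) auto
  then have "((real x - 1) / real x) powr \<rho> \<le> exp (- (\<rho> / real x))"
    using x by (simp add: powr_def)
  then have "(1 + \<rho> / real x) * ((real x - 1) / real x) powr \<rho>
      \<le> exp (\<rho> / real x) * exp (- (\<rho> / real x))"
    using exp_ge_add_one_self[of "\<rho> / real x"] assms by (intro mult_mono) auto
  then have "(1 + \<rho> / real x) * ((real x - 1) / real x) powr \<rho> \<le> 1"
    by (simp add: exp_minus)
  then have step: "(\<rho> + real x) * ((real x - 1) / real x) powr \<rho> \<le> real x"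
    using x by (simp add: field_simps)
  have "real k / real x = real k / real (x - 1) * ((real x - 1) / real x)"
    using x by simp
  then have d: "(real k / real x) powr \<rho> = a * ((real x - 1) / real x) powr \<rho>"
    unfolding a_def using x by (simp only: powr_mult[symmetric])
  have "(\<rho> + real x) * (real k / real x) powr \<rho> \<le> a * real x"
    using mult_left_mono[OF step, of a] by (simp add: d a_def mult_ac)
  then have "(\<rho> + real x) * ((\<rho> + real x) * (real k / real x) powr \<rho>) \<le> (\<rho> + real x) * (a * real x)"
    using assms by (intro mult_left_mono) auto
  moreover have "0 \<le> \<rho> * (real x * (scale_sum \<rho> (x - 1) / scale_sum \<rho> (x + 1)) + \<rho>) *
      (real k / real (x + 1)) powr \<rho>"
    using assms scale_sum_nonneg[OF assms(1)] by (intro mult_nonneg_nonneg add_nonneg_nonneg) auto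
  ultimately have "0 \<le> cat_mouse_generator (mm_inf_rate \<rho>) (profile \<rho> k \<rho>) (x, x) * (\<rho> + real x)"
    unfolding profile_generator_above[OF assms(1,2,1,3)] a_def by (simp add: mult_ac)
  then show ?thesis using assms(1) x by (simp add: zero_le_mult_iff)
qed

text \<open>
  After dropping common factors, the downward steps of the mouse contribute \<open>x\<^sup>2 + (\<rho> + \<theta>) * x\<close> up to a bounded error,
  the balance allows \<open>x\<^sup>2 + 2 * \<rho> * x\<close> up to a bounded error, and the upward steps contribute a
  bounded amount, because a cat left below the mouse returns to it only with probability of
  order \<open>1 / x\<close> or less. So \<open>\<theta> < \<rho>\<close> is enough for large \<open>x\<close>, uniformly in \<open>k\<close>.
\<close>

lemma profile_superharmonic_above:
  assumes "0 < \<theta>" "\<theta> < \<rho>"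
  shows "\<forall>\<^sub>F x in sequentially. \<forall>k. 1 \<le> k \<longrightarrow> k < x \<longrightarrow>
    cat_mouse_generator (mm_inf_rate \<rho>) (profile \<rho> k \<theta>) (x, x) \<le> 0"
proof -
  have \<rho>: "\<rho> > 0" using assms by simp
  obtain K N where K: "\<And>x. x \<ge> N \<Longrightarrow> real x * scale_ratio \<rho> x \<le> K"
    using scale_ratio_bound[OF \<rho>] by blast
  have "\<forall>\<^sub>F x in sequentially. real x * (\<rho> + real x) * (real x / (real x - 1)) powr \<theta> + \<rho> * (K + \<rho>)
      \<le> (\<rho> + real x) * (\<rho> + real x)"
    using assms by real_asymp
  then show ?thesis
    using eventually_ge_at_top[of N]
  proof (eventually_elim, intro allI impI)
    fix x k :: nat
    assume ineq: "real x * (\<rho> + real x) * (real x / (real x - 1)) powr \<theta> + \<rho> * (K + \<rho>)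
      \<le> (\<rho> + real x) * (\<rho> + real x)" and "N \<le> x" and k: "1 \<le> k" "k < x"
    define d where "d = (real k / real x) powr \<theta>"
    have x: "real x > 1" "real (x - 1) = real x - 1" using k by auto
    have "real k / real (x - 1) = real k / real x * (real x / (real x - 1))"
      using x by simp
    then have a: "(real k / real (x - 1)) powr \<theta> = d * (real x / (real x - 1)) powr \<theta>"
      unfolding d_def using x by (simp only: powr_mult[symmetric])
    have b: "(real k / real (x + 1)) powr \<theta> \<le> d"
      unfolding d_def using k assms by (intro powr_mono2 frac_le) auto
    have "real x * (scale_sum \<rho> (x - 1) / scale_sum \<rho> (x + 1)) \<le> real x * scale_ratio \<rho> x"
      using excursion_prob_le_scale_ratio[OF \<rho>, of x] by (intro mult_left_mono) auto
    also have "\<dots> \<le> K" using K[OF \<open>N \<le> x\<close>] .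
    finally have r: "real x * (scale_sum \<rho> (x - 1) / scale_sum \<rho> (x + 1)) \<le> K" .
    have "0 \<le> real x * (scale_sum \<rho> (x - 1) / scale_sum \<rho> (x + 1))"
      using scale_sum_nonneg[OF \<rho>] by simp
    with r have "\<rho> * (real x * (scale_sum \<rho> (x - 1) / scale_sum \<rho> (x + 1)) + \<rho>) *
        (real k / real (x + 1)) powr \<theta> \<le> \<rho> * (K + \<rho>) * d"
      using b \<rho> by (intro mult_mono mult_left_mono) auto
    moreover have "d * (real x * (\<rho> + real x) * (real x / (real x - 1)) powr \<theta> + \<rho> * (K + \<rho>))
      \<le> d * ((\<rho> + real x) * (\<rho> + real x))"
      using ineq by (intro mult_left_mono) (auto simp: d_def)
    ultimately have "cat_mouse_generator (mm_inf_rate \<rho>) (profile \<rho> k \<theta>) (x, x) * (\<rho> + real x) \<le> 0"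
      unfolding profile_generator_above[OF \<rho> k(1) assms(1) k(2)] a d_def[symmetric]
      by (simp add: algebra_simps)
    then show "cat_mouse_generator (mm_inf_rate \<rho>) (profile \<rho> k \<theta>) (x, x) \<le> 0"
      using \<rho> x by (simp add: mult_le_0_iff)
  qed
qed

section \<open>Bounds for the site of the mouse\<close>

locale cat_mouse_mm_inf =
  fixes \<rho> :: real and \<mu> :: "'a measure" and C M :: "real \<Rightarrow> 'a \<Rightarrow> nat" and n :: nat
  assumes rate_pos: "\<rho> > 0"
    and process: "markov_process_with_generator \<mu> (\<lambda>t \<omega>. (C t \<omega>, M t \<omega>))
      (cat_mouse_generator (mm_inf_rate \<rho>))"
    and init: "AE \<omega> in \<mu>. C 0 \<omega> = n \<and> M 0 \<omega> = n"
begin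

sublocale prob_space \<mu>
  using process unfolding markov_process_with_generator_def by blast

definition mouse_site :: "'a \<Rightarrow> nat" where
  "mouse_site \<omega> = M (enn2real (hitting_time C 0 \<omega>)) \<omega>"

lemma random_variable_mouse_site:
  fixes v :: "nat \<Rightarrow> real"
  shows "random_variable borel (\<lambda>\<omega>. v (mouse_site \<omega>))"
  using measurable_at_hitting_time[OF process, of "\<lambda>z. v (snd z)"]
  by (simp add: mouse_site_def)

lemma mouse_site_event: "{\<omega>\<in>space \<mu>. mouse_site \<omega> \<le> k} \<in> events"
proof -
  have "{\<omega>\<in>space \<mu>. (of_bool (mouse_site \<omega> \<le> k) :: real) = 1} \<in> events"
    using random_variable_mouse_site[of "\<lambda>m. of_bool (m \<le> k)"] by measurable
  then show ?thesis by simp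
qed

lemma subharmonic_bound:
  assumes "n \<ge> 1" "\<And>c m. f (c, m) \<le> 1" "\<And>m. f (0, m) \<le> indicator A m"
    and "\<And>c m. c \<ge> 1 \<Longrightarrow> 0 \<le> cat_mouse_generator (mm_inf_rate \<rho>) f (c, m)"
  shows "f (n, n) \<le> prob {\<omega>\<in>space \<mu>. hitting_time C 0 \<omega> < \<infinity> \<and> mouse_site \<omega> \<in> A}"
  using subharmonic_lower_bound[OF process rate_pos assms(1) init assms(2-4)]
  by (simp add: mouse_site_def)

text \<open>
  The constant \<open>1\<close> is subharmonic, which settles \<open>n \<ge> 1\<close>. For \<open>n = 0\<close> the cat starts at \<open>0\<close> and
  the hitting time is \<open>0\<close>.
\<close>

lemma hitting_time_finite: "AE \<omega> in \<mu>. hitting_time C 0 \<omega> < \<infinity>"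
proof (cases "n = 0")
  case True
  show ?thesis
    using init AE_space
  proof eventually_elim
    case (elim \<omega>)
    then have path: "cadlag_path (\<lambda>t. (C t \<omega>, M t \<omega>))"
      using process unfolding markov_process_with_generator_def by blast
    have C: "cadlag_path (\<lambda>t. C t \<omega>)" using cadlag_path_fst[OF path] .
    have "\<exists>t\<ge>0. C t \<omega> = 0" using elim True by auto
    then show ?case
      using hitting_time_eq_first_time[where X=C and \<omega>=\<omega> and z=0, OF C] by simp
  qed
next
  case False
  have "0 \<le> cat_mouse_generator (mm_inf_rate \<rho>) (\<lambda>_. 1) (c, m)" if "c \<ge> 1" for c m
    using that rate_pos
    by (cases "c = m") (simp_all add: cat_mouse_generator_apart cat_mouse_generator_together)
  then have "1 \<le> prob {\<omega>\<in>space \<mu>. hitting_time C 0 \<omega> < \<infinity> \<and> mouse_site \<omega> \<in> UNIV}"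
    using False by (intro subharmonic_bound[where f="\<lambda>_. 1"]) auto
  then have "prob {\<omega>\<in>space \<mu>. hitting_time C 0 \<omega> < \<infinity>} = 1"
    by (intro antisym prob_le_1) simp
  moreover have "{\<omega>\<in>space \<mu>. hitting_time C 0 \<omega> < \<infinity>} \<in> events"
    using hitting_event_measurable[OF process, of UNIV] by simp
  ultimately have "AE \<omega> in \<mu>. \<omega> \<in> {\<omega>\<in>space \<mu>. hitting_time C 0 \<omega> < \<infinity>}"
    by (simp only: prob_eq_1)
  then show ?thesis by eventually_elim simp
qed

text \<open>
  The profile with exponent \<open>\<rho>\<close> is subharmonic except at the meeting site \<open>k\<close>, where its drift
  may go down to \<open>- \<rho>\<close>. The function \<open>b\<close> of the mouse position, the scale function stopped at
  \<open>k\<close> and suitably normalised, has drift \<open>- \<rho>\<close> exactly there and none elsewhere. Subtracting it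
  repairs the sign at the cost of \<open>scale_ratio \<rho> k\<close>.
\<close>

lemma mouse_site_prob_lower:
  assumes "1 \<le> k" "k \<le> n"
  shows "(real k / real n) powr \<rho> - scale_ratio \<rho> k \<le> prob {\<omega>\<in>space \<mu>. mouse_site \<omega> \<le> k}"
proof -
  define g where "g m = scale_sum \<rho> (min m k) / (fact k / \<rho> ^ k)" for m
  define b where b: "b = (\<lambda>(c::nat, m). g m)"
  have g_nonneg: "0 \<le> g m" for m
    unfolding g_def using scale_sum_nonneg[OF rate_pos] rate_pos by simp
  have gen_b: "cat_mouse_generator (mm_inf_rate \<rho>) b (x, x) = (if x = k then - \<rho> else 0)"
    if "x \<ge> 1" for x
  proof -
    have eq: "cat_mouse_generator (mm_inf_rate \<rho>) b (x, x) =
        \<rho> * (g (x + 1) - g x) + real x * (g (x - 1) - g x)"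
      unfolding b by (rule cat_mouse_generator_mouse_only[OF that rate_pos])
    consider "x < k" | "x = k" | "x > k" by linarith
    then show ?thesis
    proof cases
      case 1
      have "\<rho> * (g (x + 1) - g x) + real x * (g (x - 1) - g x) =
          (\<rho> * (scale_sum \<rho> (x + 1) - scale_sum \<rho> x) + real x * (scale_sum \<rho> (x - 1) - scale_sum \<rho> x))
            / (fact k / \<rho> ^ k)"
        using 1 unfolding g_def by (simp add: min_absorb1 diff_divide_distrib add_divide_distrib algebra_simps)
      then show ?thesis using 1 unfolding eq scale_sum_harmonic[OF that rate_pos] by simp
    next
      case 2
      then obtain y where y: "k = Suc y" using assms by (cases k) auto
      have "real x * (g (x - 1) - g x) = - (real k * (fact y / \<rho> ^ y) / (fact k / \<rho> ^ k))"
        using 2 unfolding g_def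
        by (simp add: y min_absorb1 scale_sum_Suc add_divide_distrib algebra_simps)
      also have "real k * (fact y / \<rho> ^ y) = \<rho> * (fact k / \<rho> ^ k)"
        using rate_pos by (simp add: y field_simps)
      finally show ?thesis using 2 rate_pos unfolding eq by (simp add: g_def)
    next
      case 3
      then show ?thesis unfolding eq by (simp add: g_def min_absorb2)
    qed
  qed
  let ?f = "\<lambda>z. profile \<rho> k \<rho> z - 1 * b z"
  have "?f (n, n) \<le> prob {\<omega>\<in>space \<mu>. hitting_time C 0 \<omega> < \<infinity> \<and> mouse_site \<omega> \<in> {..k}}"
  proof (rule subharmonic_bound)
    show "n \<ge> 1" using assms by simp
    show "?f (c, m) \<le> 1" for c m
      using profile_bounds(2)[OF rate_pos rate_pos, of k c m] g_nonneg[of m] by (simp add: b)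
    show "?f (0, m) \<le> indicator {..k} m" for m
      using g_nonneg[of m] by (auto simp: b profile_def)
    show "0 \<le> cat_mouse_generator (mm_inf_rate \<rho>) ?f (c, m)" if c: "c \<ge> 1" for c m
    proof (cases "c = m")
      case False
      have "cat_mouse_generator (mm_inf_rate \<rho>) b (c, m) = 0"
        using c False by (simp add: cat_mouse_generator_apart b)
      then show ?thesis
        using profile_generator_apart[OF rate_pos c False]
        unfolding cat_mouse_generator_diff[OF c rate_pos] by simp
    next
      case True
      have "(if c = k then - \<rho> else 0) \<le> cat_mouse_generator (mm_inf_rate \<rho>) (profile \<rho> k \<rho>) (c, c)"
        using profile_generator_below[OF rate_pos c, of k] profile_subharmonic_above[OF rate_pos assms(1), of c]
          profile_generator_at_level(1)[OF rate_pos assms(1) rate_pos]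
        by (cases c k rule: linorder_cases) auto
      then show ?thesis
        using True[symmetric] gen_b[OF c]
        unfolding cat_mouse_generator_diff[OF c rate_pos] by simp
    qed
  qed
  also have "\<dots> \<le> prob {\<omega>\<in>space \<mu>. mouse_site \<omega> \<le> k}"
    using mouse_site_event by (intro finite_measure_mono) auto
  also have "?f (n, n) = (real k / real n) powr \<rho> - scale_ratio \<rho> k"
    using assms rate_pos by (simp add: profile_cat_above b g_def scale_ratio_def)
  finally show ?thesis .
qed

text \<open>
  The comparison principle for one minus a superharmonic profile, applied to the complementary
  event.
\<close>

lemma mouse_site_prob_upper:
  assumes "1 \<le> k" "k \<le> n" "0 < \<theta>"
    and above: "\<And>x. k < x \<Longrightarrow> cat_mouse_generator (mm_inf_rate \<rho>) (profile \<rho> k \<theta>) (x, x) \<le> 0"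
  shows "prob {\<omega>\<in>space \<mu>. mouse_site \<omega> \<le> k} \<le> (real k / real n) powr \<theta>"
proof -
  let ?f = "\<lambda>z. 1 - 1 * profile \<rho> k \<theta> z"
  have "?f (n, n) \<le> prob {\<omega>\<in>space \<mu>. hitting_time C 0 \<omega> < \<infinity> \<and> mouse_site \<omega> \<in> {k<..}}"
  proof (rule subharmonic_bound)
    show "n \<ge> 1" using assms by simp
    show "?f (c, m) \<le> 1" for c m
      using profile_bounds(1)[OF rate_pos assms(3), of k c m] by simp
    show "?f (0, m) \<le> indicator {k<..} m" for m
      by (auto simp: profile_def)
    show "0 \<le> cat_mouse_generator (mm_inf_rate \<rho>) ?f (c, m)" if c: "c \<ge> 1" for c m
    proof -
      have "cat_mouse_generator (mm_inf_rate \<rho>) (\<lambda>_. 1) (c, m) = 0"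
        using c rate_pos
        by (cases "c = m") (simp_all add: cat_mouse_generator_apart cat_mouse_generator_together)
      moreover have "cat_mouse_generator (mm_inf_rate \<rho>) (profile \<rho> k \<theta>) (c, m) \<le> 0"
        using profile_generator_apart[OF rate_pos c, of m k \<theta>] profile_generator_below[OF rate_pos c, of k \<theta>]
          profile_generator_at_level(2)[OF rate_pos assms(1,3)] above[of c]
        by (cases c k rule: linorder_cases; cases "c = m") auto
      ultimately show ?thesis unfolding cat_mouse_generator_diff[OF c rate_pos] by simp
    qed
  qed
  also have "\<dots> \<le> prob (space \<mu> - {\<omega>\<in>space \<mu>. mouse_site \<omega> \<le> k})"
    using mouse_site_event by (intro finite_measure_mono) auto
  also have "\<dots> = 1 - prob {\<omega>\<in>space \<mu>. mouse_site \<omega> \<le> k}"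
    using mouse_site_event by (rule prob_compl)
  also have "?f (n, n) = 1 - (real k / real n) powr \<theta>"
    using assms rate_pos by (simp add: profile_cat_above)
  finally show ?thesis by simp
qed

end

section \<open>Convergence to the power law\<close>

text \<open>
  Passage from the integer levels \<open>k\<close> to real arguments, with \<open>k = \<lfloor>y * n\<rfloor>\<close>. The upper bound
  holds for every exponent below \<open>\<rho>\<close>, and \<open>y powr \<theta>\<close> tends to \<open>y powr \<rho>\<close> as \<open>\<theta>\<close> increases to \<open>\<rho>\<close>.
  At \<open>0\<close> and from \<open>1\<close> on the limit follows from monotonicity and the bounds \<open>0\<close> and \<open>1\<close>.
\<close>

lemma tendsto_power_law:
  fixes G :: "nat \<Rightarrow> real \<Rightarrow> real"
  assumes \<rho>: "\<rho> > 0" and \<eta>: "\<eta> \<longlonglongrightarrow> 0"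
    and lower: "\<And>n k. 1 \<le> k \<Longrightarrow> k \<le> n \<Longrightarrow> (real k / real n) powr \<rho> - \<eta> k \<le> G n (real k / real n)"
    and upper: "\<And>\<theta>. 0 < \<theta> \<Longrightarrow> \<theta> < \<rho> \<Longrightarrow>
      \<forall>\<^sub>F k in sequentially. \<forall>n\<ge>k. \<forall>x. x < real (k + 1) / real n \<longrightarrow> G n x \<le> (real k / real n) powr \<theta>"
    and mono: "\<And>n x y. x \<le> y \<Longrightarrow> G n x \<le> G n y"
    and negative: "\<And>n x. x < 0 \<Longrightarrow> G n x = 0"
    and range: "\<And>n x. 0 \<le> G n x" "\<And>n x. G n x \<le> 1"
  shows "(\<lambda>n. G n x) \<longlonglongrightarrow> max 0 (min 1 x) powr \<rho>"
proof -
  define k where "k y n = nat \<lfloor>y * real n\<rfloor>" for y n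
  have k_lim: "filterlim (k y) at_top sequentially" if "0 < y" for y
    unfolding k_def using that by real_asymp
  have k_ratio: "(\<lambda>n. real (k y n) / real n) \<longlonglongrightarrow> y" if "0 < y" for y
    unfolding k_def using that by real_asymp
  have lower_lim: "\<forall>\<^sub>F n in sequentially. a < G n y" if y: "0 < y" "y \<le> 1" and a: "a < y powr \<rho>" for y a
  proof -
    have "(\<lambda>n. (real (k y n) / real n) powr \<rho> - \<eta> (k y n)) \<longlonglongrightarrow> y powr \<rho> - 0"
      using y by (intro tendsto_intros k_ratio filterlim_compose[OF \<eta> k_lim]) auto
    then have "\<forall>\<^sub>F n in sequentially. a < (real (k y n) / real n) powr \<rho> - \<eta> (k y n)"
      using a by (intro order_tendstoD) auto
    moreover have "\<forall>\<^sub>F n in sequentially. k y n \<ge> 1"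
      using k_lim[OF y(1)] by (simp add: filterlim_at_top)
    ultimately show ?thesis
      using eventually_gt_at_top[of 0]
    proof eventually_elim
      case (elim n)
      have kn: "real (k y n) \<le> y * real n"
        unfolding k_def using y by (simp add: of_nat_nat)
      also have "\<dots> \<le> real n" using y by (simp add: mult_left_le_one_le)
      finally have "k y n \<le> n" by simp
      with elim have "a < G n (real (k y n) / real n)" using lower[of "k y n" n] by linarith
      also have "\<dots> \<le> G n y" using kn elim by (intro mono) (simp add: field_simps)
      finally show ?case .
    qed
  qed
  have upper_lim: "\<forall>\<^sub>F n in sequentially. G n y < a" if y: "0 < y" "y < 1" and a: "y powr \<rho> < a" for y a
  proof -
    have "((\<lambda>\<theta>. y powr \<theta>) \<longlongrightarrow> y powr \<rho>) (at_left \<rho>)"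
      using y by (intro tendsto_intros) auto
    then have "\<forall>\<^sub>F \<theta> in at_left \<rho>. y powr \<theta> < a" using a by (rule order_tendstoD)
    moreover have "\<forall>\<^sub>F \<theta> in at_left \<rho>. \<theta> \<in> {0<..<\<rho>}" using \<rho> by (rule eventually_at_left_real)
    ultimately have "\<forall>\<^sub>F \<theta> in at_left \<rho>. y powr \<theta> < a \<and> \<theta> \<in> {0<..<\<rho>}" by eventually_elim simp
    then obtain \<theta> where \<theta>: "y powr \<theta> < a" "0 < \<theta>" "\<theta> < \<rho>"
      using eventually_happens[of _ "at_left \<rho>"] by (auto simp: trivial_limit_at_left_real)
    have "\<forall>\<^sub>F n in sequentially. \<forall>m\<ge>k y n. \<forall>x. x < real (k y n + 1) / real m \<longrightarrow>
        G m x \<le> (real (k y n) / real m) powr \<theta>"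
      using eventually_compose_filterlim[OF upper[OF \<theta>(2,3)] k_lim[OF y(1)]] .
    then show ?thesis
      using eventually_gt_at_top[of 0]
    proof eventually_elim
      case (elim n)
      have kn: "real (k y n) \<le> y * real n" "y * real n < real (k y n) + 1"
        unfolding k_def using y by (simp_all add: of_nat_nat)
      have "y * real n \<le> real n" using y by (simp add: mult_left_le_one_le)
      with kn have "k y n \<le> n" by linarith
      moreover have "y < real (k y n + 1) / real n" using kn(2) elim by (simp add: field_simps)
      ultimately have "G n y \<le> (real (k y n) / real n) powr \<theta>" using elim by blast
      also have "\<dots> \<le> y powr \<theta>" using kn(1) elim \<theta> by (intro powr_mono2) (auto simp: field_simps)
      finally show ?case using \<theta>(1) by simp
    qed
  qed
  show ?thesis
  proof (rule order_tendstoI)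
    fix a assume a: "a < max 0 (min 1 x) powr \<rho>"
    show "\<forall>\<^sub>F n in sequentially. a < G n x"
    proof (cases "0 < x")
      case True
      then have "\<forall>\<^sub>F n in sequentially. a < G n (min 1 x)"
        using a by (intro lower_lim) auto
      then show ?thesis
        by eventually_elim (use mono[of "min 1 x" x] in \<open>auto intro: less_le_trans\<close>)
    next
      case False
      then have "a < 0" using a by simp
      then show ?thesis using range(1) by (auto intro!: always_eventually less_le_trans[of a 0])
    qed
  next
    fix a assume a: "max 0 (min 1 x) powr \<rho> < a"
    consider "x < 0" | "x = 0" | "0 < x" "x < 1" | "1 \<le> x" by linarith
    then show "\<forall>\<^sub>F n in sequentially. G n x < a"
    proof cases
      case 1
      then show ?thesis using a negative by simp
    next
      case 2
      have "((\<lambda>y. y powr \<rho>) \<longlongrightarrow> 0) (at_right 0)" using \<rho> by real_asymp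
      then have "\<forall>\<^sub>F y in at_right 0. y powr \<rho> < a" using a 2 by (intro order_tendstoD) auto
      moreover have "\<forall>\<^sub>F y in at_right (0::real). y \<in> {0<..<1}" by (rule eventually_at_right_real) simp
      ultimately have "\<forall>\<^sub>F y in at_right (0::real). y powr \<rho> < a \<and> y \<in> {0<..<1}" by eventually_elim simp
      then obtain y where y: "y powr \<rho> < a" "0 < y" "y < 1"
        using eventually_happens[of _ "at_right (0::real)"] by (auto simp: trivial_limit_at_right_real)
      from upper_lim[OF y(2,3,1)] show ?thesis
        by eventually_elim (use mono[of x y] 2 y in \<open>auto intro: le_less_trans\<close>)
    next
      case 3
      then show ?thesis using a by (intro upper_lim) auto
    next
      case 4
      then show ?thesis using a range(2) by (auto intro!: always_eventually le_less_trans[of _ 1])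
    qed
  qed
qed

text \<open>
  Inversion: a uniform variable raised to the power \<open>1 / \<rho>\<close>. Clamping to the unit interval only
  matters on a null set, but it keeps every value in \<open>[0, 1]\<close>.
\<close>

lemma power_law_variable:
  fixes \<rho> :: real
  assumes "\<rho> > 0"
  defines "N \<equiv> uniform_measure lborel {0..1::real}"
    and "F \<equiv> \<lambda>\<omega>::real. max 0 (min 1 \<omega>) powr (1 / \<rho>)"
  shows "prob_space N" "F \<in> borel_measurable N" "\<And>\<omega>. F \<omega> \<in> {0..1}"
    "\<And>x. x \<in> {0..1} \<Longrightarrow> measure N {\<omega>\<in>space N. F \<omega> \<le> x} = x powr \<rho>"
    "\<And>x. cdf (distr N borel F) x = max 0 (min 1 x) powr \<rho>"
proof -
  show ps: "prob_space N" unfolding N_def by (intro prob_space_uniform_measure) auto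
  have "F \<in> borel_measurable borel" unfolding F_def by measurable
  then show F: "F \<in> borel_measurable N" by (simp add: N_def)
  show F01: "F \<omega> \<in> {0..1}" for \<omega>
    unfolding F_def using assms by (auto intro!: powr_le1)
  interpret prob_space N by (rule ps)
  show eq: "measure N {\<omega>\<in>space N. F \<omega> \<le> x} = x powr \<rho>" if x: "x \<in> {0..1}" for x
  proof -
    have *: "F \<omega> \<le> x \<longleftrightarrow> max 0 (min 1 \<omega>) \<le> x powr \<rho>" for \<omega>
    proof -
      have "F \<omega> \<le> x \<longleftrightarrow> F \<omega> powr \<rho> \<le> x powr \<rho>"
        using powr_mono2[of \<rho> "F \<omega>" x] powr_less_mono2[of \<rho> x "F \<omega>"] assms(1) x F01[of \<omega>]
        by (cases "F \<omega> \<le> x") (simp_all add: not_le)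
      also have "F \<omega> powr \<rho> = max 0 (min 1 \<omega>)"
        using assms by (simp add: F_def powr_powr)
      finally show ?thesis .
    qed
    have "x powr \<rho> \<le> 1" using assms x by (intro powr_le1) auto
    then have "{0..1} \<inter> {\<omega>. F \<omega> \<le> x} = {0..x powr \<rho>}"
      by (auto simp: *)
    moreover have "{\<omega>. F \<omega> \<le> x} \<in> sets borel"
      using \<open>F \<in> borel_measurable borel\<close> by measurable
    ultimately show ?thesis
      by (simp add: N_def)
  qed
  show "cdf (distr N borel F) x = max 0 (min 1 x) powr \<rho>" for x
  proof -
    have cdf: "cdf (distr N borel F) x = measure N {\<omega>\<in>space N. F \<omega> \<le> x}"
      unfolding cdf_def using F by (subst measure_distr) (auto intro!: arg_cong[where f="measure N"])
    consider "x < 0" | "0 \<le> x" "x \<le> 1" | "1 < x" by linarith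
    then show ?thesis
    proof cases
      case 1
      then have "\<not> F \<omega> \<le> x" for \<omega> using F01[of \<omega>] by auto
      then have empty: "{\<omega>\<in>space N. F \<omega> \<le> x} = {}" by simp
      show ?thesis using 1 unfolding cdf empty by simp
    next
      case 2
      then show ?thesis using cdf eq[of x] by simp
    next
      case 3
      then have "F \<omega> \<le> x" for \<omega> using F01[of \<omega>] by auto
      then have full: "{\<omega>\<in>space N. F \<omega> \<le> x} = space N" by simp
      show ?thesis using 3 prob_space unfolding cdf full by simp
    qed
  qed
qed

theorem proposition8:
  fixes \<rho> :: real
    and \<mu> :: "nat \<Rightarrow> 'a measure"
    and C M :: "nat \<Rightarrow> real \<Rightarrow> 'a \<Rightarrow> nat"
    and T\<^sub>0 :: "nat \<Rightarrow> 'a \<Rightarrow> ennreal"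
  assumes rho: "\<rho> > 0"
    and process: "\<And>n. markov_process_with_generator (\<mu> n) (\<lambda>t \<omega>. (C n t \<omega>, M n t \<omega>))
                          (cat_mouse_generator (mm_inf_rate \<rho>))"
    and init: "\<And>n. AE \<omega> in \<mu> n. C n 0 \<omega> = n \<and> M n 0 \<omega> = n"
    and T\<^sub>0_def: "\<And>n \<omega>. T\<^sub>0 n \<omega> = hitting_time (C n) 0 \<omega>"
  shows "(\<forall>n. AE \<omega> in \<mu> n. T\<^sub>0 n \<omega> < \<infinity>) \<and>
     (\<forall>n. (\<lambda>\<omega>. real (M n (enn2real (T\<^sub>0 n \<omega>)) \<omega>) / real n) \<in> borel_measurable (\<mu> n)) \<and>
     (\<exists>(N :: real measure) F.
        prob_space N \<and> F \<in> borel_measurable N \<and>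
        (\<forall>\<omega>\<in>space N. F \<omega> \<in> {0..1}) \<and>
        (\<forall>x\<in>{0..1}. measure N {\<omega>\<in>space N. F \<omega> \<le> x} = x powr \<rho>) \<and>
        weak_conv_m
          (\<lambda>n. distr (\<mu> n) borel (\<lambda>\<omega>. real (M n (enn2real (T\<^sub>0 n \<omega>)) \<omega>) / real n))
          (distr N borel F))"
proof -
  have cm: "cat_mouse_mm_inf \<rho> (\<mu> n) (C n) (M n) n" for n
    by standard (fact rho process init)+
  define S where "S n = cat_mouse_mm_inf.mouse_site (C n) (M n)" for n
  have S: "M n (enn2real (T\<^sub>0 n \<omega>)) \<omega> = S n \<omega>" for n \<omega>
    by (simp add: S_def T\<^sub>0_def cat_mouse_mm_inf.mouse_site_def[OF cm])
  have rv: "(\<lambda>\<omega>. real (S n \<omega>) / real n) \<in> borel_measurable (\<mu> n)" for n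
    unfolding S_def by (rule cat_mouse_mm_inf.random_variable_mouse_site[OF cm])
  define G where "G n = cdf (distr (\<mu> n) borel (\<lambda>\<omega>. real (S n \<omega>) / real n))" for n
  have prob: "prob_space (\<mu> n)" for n using process unfolding markov_process_with_generator_def by blast
  have rd: "real_distribution (distr (\<mu> n) borel (\<lambda>\<omega>. real (S n \<omega>) / real n))" for n
    using prob_space.real_distribution_distr[OF prob rv] .
  have G_eq: "G n x = measure (\<mu> n) {\<omega>\<in>space (\<mu> n). real (S n \<omega>) / real n \<le> x}" for n x
    unfolding G_def cdf_def
    by (subst measure_distr[OF rv]) (auto intro!: arg_cong[where f="measure (\<mu> n)"])
  have "(\<lambda>n. G n x) \<longlonglongrightarrow> max 0 (min 1 x) powr \<rho>" for x
  proof (rule tendsto_power_law[where G=G and \<eta>="scale_ratio \<rho>", OF rho scale_ratio_tendsto_0[OF rho]])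
    fix n k :: nat assume k: "1 \<le> k" "k \<le> n"
    have "real (S n \<omega>) / real n \<le> real k / real n \<longleftrightarrow> S n \<omega> \<le> k" for \<omega>
      using k by (simp add: divide_le_cancel)
    then show "(real k / real n) powr \<rho> - scale_ratio \<rho> k \<le> G n (real k / real n)"
      using cat_mouse_mm_inf.mouse_site_prob_lower[OF cm k] by (simp add: G_eq S_def)
  next
    fix \<theta> assume \<theta>: "0 < \<theta>" "\<theta> < \<rho>"
    obtain x\<^sub>0 where x\<^sub>0: "\<And>x k. x \<ge> x\<^sub>0 \<Longrightarrow> 1 \<le> k \<Longrightarrow> k < x \<Longrightarrow>
        cat_mouse_generator (mm_inf_rate \<rho>) (profile \<rho> k \<theta>) (x, x) \<le> 0"
      using profile_superharmonic_above[OF \<theta>] unfolding eventually_sequentially by blast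
    show "\<forall>\<^sub>F k in sequentially. \<forall>n\<ge>k. \<forall>x. x < real (k + 1) / real n \<longrightarrow>
        G n x \<le> (real k / real n) powr \<theta>"
      using eventually_ge_at_top[of "max 1 x\<^sub>0"]
    proof (eventually_elim, intro allI impI)
      fix k n :: nat and x :: real
      assume k: "max 1 x\<^sub>0 \<le> k" "k \<le> n" and x: "x < real (k + 1) / real n"
      interpret prob_space "\<mu> n" by (rule prob)
      have "S n \<omega> \<le> k" if "real (S n \<omega>) / real n \<le> x" for \<omega>
      proof -
        have "real (S n \<omega>) / real n < real (k + 1) / real n" using that x by simp
        then have "real (S n \<omega>) < real (k + 1)" using k by (simp only: divide_less_cancel)
        then show ?thesis by simp
      qed
      then have "G n x \<le> measure (\<mu> n) {\<omega>\<in>space (\<mu> n). S n \<omega> \<le> k}"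
        unfolding G_eq S_def
        by (intro finite_measure_mono cat_mouse_mm_inf.mouse_site_event[OF cm]) auto
      also have "\<dots> \<le> (real k / real n) powr \<theta>"
        unfolding S_def using k x\<^sub>0 \<theta>
        by (intro cat_mouse_mm_inf.mouse_site_prob_upper[OF cm]) auto
      finally show "G n x \<le> (real k / real n) powr \<theta>" .
    qed
  next
    fix n x y assume "x \<le> (y :: real)"
    then show "G n x \<le> G n y" unfolding G_def
      using finite_borel_measure.cdf_nondecreasing[OF real_distribution.finite_borel_measure_M[OF rd]] by blast
  next
    fix n and x :: real assume "x < 0"
    then have "{\<omega>\<in>space (\<mu> n). real (S n \<omega>) / real n \<le> x} = {}"
      by (auto simp: not_le intro: less_le_trans)
    then show "G n x = 0" by (simp only: G_eq measure_empty)
  next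
    show "0 \<le> G n x" "G n x \<le> 1" for n x
      using prob_space.prob_le_1[OF prob] by (auto simp: G_eq)
  qed
  then have "weak_conv_m (\<lambda>n. distr (\<mu> n) borel (\<lambda>\<omega>. real (S n \<omega>) / real n))
      (distr (uniform_measure lborel {0..1}) borel (\<lambda>\<omega>. max 0 (min 1 \<omega>) powr (1 / \<rho>)))"
    unfolding weak_conv_m_def weak_conv_def by (simp add: power_law_variable(5)[OF rho] G_def)
  then show ?thesis
    unfolding S
    using cat_mouse_mm_inf.hitting_time_finite[OF cm] rv power_law_variable(1-4)[OF rho]
    by (auto simp: T\<^sub>0_def intro!: exI[of _ "uniform_measure lborel {0..1::real}"]
      exI[of _ "\<lambda>\<omega>::real. max 0 (min 1 \<omega>) powr (1 / \<rho>)"])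
qed

end
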